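(* Let $\mu_{J,n}$ be the Curie–Weiss model on $[n]$ with parameter $J=\beta/n$, and let $X_n\in\{0,1\}^n$ be the corresponding $\{0,1\}$-valued random vector, obtained from $\sigma\sim\mu_{J,n}$ by identifying $-1$ with $0$. If $\beta>\beta_c$, then for all sufficiently large $n$ one has $X_n\notin\mathcal{R}$.
   Context: For a finite set $S$ and a $\sigma$-finite measure $\nu$ on $\mathcal{P}(S)\setminus\{\emptyset\}$ (where $\mathcal{P}(S)$ is the power set), let $Y^\nu=\{B_j\}_{j\in I}$ be the Poisson process on $\mathcal{P}(S)\setminus\{\emptyset\}$ with intensity measure $\nu$. Define $X^\nu=(X^\nu_i)_{i\in S}$ by $X^\nu_i=1$ if $i\in\bigcup_{j\in I}B_j$ and $X^\nu_i=0$ otherwise. $\mathcal{R}$ denotes the set of all $\{0,1\}$-valued processes $(X_i)_{i\in S}$ that are equal in distribution to $X^\nu$ for some $\nu$. Here $S=[n]=\{1,\dots,n\}$. The Curie–Weiss model on $[n]$ with parameter $J$ is the probability measure $\mu_{J,n}(\sigma)=Z_{J,n}^{-1}\exp\bigl(J\sum_{i<j}\sigma_i\sigma_j\bigr)$, $\sigma\in\{-1,1\}^n$, where $Z_{J,n}$ is the normalizing constant. The critical value $\beta_c\in(0,\infty)$ is characterized as follows: with $J=\beta/n$, $\sigma\sim\mu_{J,n}$ and $\bar\sigma=\frac1n\sum_i\sigma_i$, the mean $\bar\sigma$ concentrates at $\pm c_\beta$ as $n\to\infty$ (i.e. $|\bar\sigma|\to c_\beta$ in probability), where $c_\beta=0$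 if $\beta\le\beta_c$ and $0<c_\beta<1$ if $\beta>\beta_c$. *)

theory Defs
  imports "HOL-Probability.Probability"
begin

section \<open>Poisson processes and the class \<open>\<R>\<close>\<close>

text \<open>
  A configuration of points is a multiset, so that points may be repeated. The number of points
  of a Poisson process in a set \<open>A\<close> is Poisson distributed with mean \<open>\<nu> A\<close>, and the numbers of
  points in pairwise disjoint sets are independent. The definition is meant for finite measures
  \<open>\<nu>\<close> only, which covers all \<open>\<sigma>\<close>-finite measures on a finite discrete space. The Poisson weights
  are spelled out because \<^const>\<open>poisson_pmf\<close> is unspecified at rate \<open>0\<close>; here rate \<open>0\<close> gives the
  point mass at \<open>0\<close>, as \<open>0 ^ 0 = 1\<close>.
\<close>

definition num_points :: "'b set \<Rightarrow> 'b multiset \<Rightarrow> nat" where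
  "num_points A y = size (filter_mset (\<lambda>b. b \<in> A) y)"

definition poisson_process ::
    "'w measure \<Rightarrow> 'b measure \<Rightarrow> ('w \<Rightarrow> 'b multiset) \<Rightarrow> bool" where
  "poisson_process M \<nu> Y \<longleftrightarrow>
     prob_space M \<and>
     Y \<in> measurable M (count_space UNIV) \<and>
     (AE \<omega> in M. set_mset (Y \<omega>) \<subseteq> space \<nu>) \<and>
     (\<forall>A\<in>sets \<nu>. \<forall>k. measure M {\<omega>\<in>space M. num_points A (Y \<omega>) = k}
        = measure \<nu> A ^ k / fact k * exp (- measure \<nu> A)) \<and>
     (\<forall>\<A>. finite \<A> \<and> \<A> \<subseteq> sets \<nu> \<and> disjoint \<A> \<longrightarrow>
        prob_space.indep_vars M (\<lambda>_. count_space UNIV) (\<lambda>A \<omega>. num_points A (Y \<omega>)) \<A>)"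

definition covered :: "'a set \<Rightarrow> 'a set multiset \<Rightarrow> 'a \<Rightarrow> nat" where
  "covered S y = (\<lambda>i\<in>S. if i \<in> \<Union>(set_mset y) then 1 else 0)"

text \<open>
  A \<open>{0,1}\<close>-valued process indexed by \<open>S\<close> is represented by its law on \<open>S \<rightarrow>\<^sub>E {0,1}\<close>. Membership in
  \<open>\<R>\<close> only depends on the law of the Poisson process, which we realise as the identity on the
  space of configurations; \<open>poisson_process_in_poisson_representable\<close> below shows that this
  covers Poisson processes on arbitrary probability spaces.
\<close>

definition poisson_representable :: "'a set \<Rightarrow> ('a \<Rightarrow> nat) pmf set" where
  "poisson_representable S =
     {map_pmf (covered S) Q | (\<nu> :: 'a set measure) (Q :: 'a set multiset pmf).
        sigma_finite_measure \<nu> \<and> space \<nu> = Pow S - {{}} \<and> sets \<nu> = Pow (Pow S - {{}}) \<and>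
        poisson_process (measure_pmf Q) \<nu> (\<lambda>y. y)}"


section \<open>The Curie--Weiss model\<close>

definition spin_configs :: "nat \<Rightarrow> (nat \<Rightarrow> real) set" where
  "spin_configs n = {1..n} \<rightarrow>\<^sub>E {-1, 1}"

definition cw_weight :: "nat \<Rightarrow> real \<Rightarrow> (nat \<Rightarrow> real) \<Rightarrow> real" where
  "cw_weight n J \<sigma> = exp (J * (\<Sum>(i, j) \<in> {(i, j). 1 \<le> i \<and> i < j \<and> j \<le> n}. \<sigma> i * \<sigma> j))"

definition cw_partition :: "nat \<Rightarrow> real \<Rightarrow> real" where
  "cw_partition n J = (\<Sum>\<sigma>\<in>spin_configs n. cw_weight n J \<sigma>)"

definition curie_weiss :: "nat \<Rightarrow> real \<Rightarrow> (nat \<Rightarrow> real) pmf" where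
  "curie_weiss n J =
     embed_pmf (\<lambda>\<sigma>. if \<sigma> \<in> spin_configs n then cw_weight n J \<sigma> / cw_partition n J else 0)"

definition magnetization :: "nat \<Rightarrow> (nat \<Rightarrow> real) \<Rightarrow> real" where
  "magnetization n \<sigma> = (\<Sum>i=1..n. \<sigma> i) / n"

definition concentrates_at :: "real \<Rightarrow> real \<Rightarrow> bool" where
  "concentrates_at \<beta> c \<longleftrightarrow>
     (\<forall>\<epsilon>>0. (\<lambda>n. measure_pmf.prob (curie_weiss n (\<beta> / real n))
        {\<sigma>. \<bar>\<bar>magnetization n \<sigma>\<bar> - c\<bar> > \<epsilon>}) \<longlonglongrightarrow> 0)"

text \<open>
  The critical value is pinned down by the behaviour of the limit \<open>c\<^sub>\<beta>\<close> of the absolute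
  magnetization; \<open>\<beta>\<close> ranges over all reals, including the antiferromagnetic ones.
\<close>

definition critical_beta :: real where
  "critical_beta = (THE b. 0 < b \<and>
     (\<exists>c :: real \<Rightarrow> real. \<forall>\<beta>. concentrates_at \<beta> (c \<beta>) \<and>
        (\<beta> \<le> b \<longrightarrow> c \<beta> = 0) \<and> (\<beta> > b \<longrightarrow> 0 < c \<beta> \<and> c \<beta> < 1)))"

definition curie_weiss_01 :: "nat \<Rightarrow> real \<Rightarrow> (nat \<Rightarrow> nat) pmf" where
  "curie_weiss_01 n J =
     map_pmf (\<lambda>\<sigma>. \<lambda>i\<in>{1..n}. if \<sigma> i = -1 then 0 else 1) (curie_weiss n J)"


section \<open>Well-definedness\<close>

lemma finite_spin_configs: "finite (spin_configs n)"
  unfolding spin_configs_def by (intro finite_PiE) auto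

lemma cw_partition_pos: "cw_partition n J > 0"
proof -
  have "spin_configs n \<noteq> {}" by (auto simp: spin_configs_def PiE_eq_empty_iff)
  thus ?thesis unfolding cw_partition_def
    by (intro sum_pos finite_spin_configs) (auto simp: cw_weight_def)
qed

lemma pmf_curie_weiss:
  "pmf (curie_weiss n J) \<sigma> =
     (if \<sigma> \<in> spin_configs n then cw_weight n J \<sigma> / cw_partition n J else 0)"
  unfolding curie_weiss_def
proof (rule pmf_embed_pmf)
  show nn: "0 \<le> (if \<sigma> \<in> spin_configs n then cw_weight n J \<sigma> / cw_partition n J else 0)" for \<sigma>
    using cw_partition_pos[of n J] by (auto simp: cw_weight_def)
  have "(\<integral>\<^sup>+\<sigma>. ennreal (if \<sigma> \<in> spin_configs n then cw_weight n J \<sigma> / cw_partition n J else 0)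
          \<partial>count_space UNIV)
      = (\<Sum>\<sigma>\<in>spin_configs n. ennreal (cw_weight n J \<sigma> / cw_partition n J))"
    by (subst nn_integral_count_space'[of "spin_configs n"])
       (use finite_spin_configs[of n] in auto)
  also have "\<dots> = ennreal (\<Sum>\<sigma>\<in>spin_configs n. cw_weight n J \<sigma> / cw_partition n J)"
    using cw_partition_pos[of n J] by (intro sum_ennreal) (auto simp: cw_weight_def)
  also have "(\<Sum>\<sigma>\<in>spin_configs n. cw_weight n J \<sigma> / cw_partition n J) = 1"
    using cw_partition_pos[of n J]
    by (simp add: sum_divide_distrib[symmetric] cw_partition_def[symmetric])
  finally show "(\<integral>\<^sup>+\<sigma>. ennreal (if \<sigma> \<in> spin_configs n
      then cw_weight n J \<sigma> / cw_partition n J else 0) \<partial>count_space UNIV) = 1" by simp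
qed

lemma poisson_process_distr:
  assumes Y: "poisson_process M \<nu> Y"
  shows "poisson_process (distr M (count_space UNIV) Y) \<nu> (\<lambda>y. y)"
proof -
  interpret prob_space M using Y by (simp add: poisson_process_def)
  have Ym[measurable]: "Y \<in> measurable M (count_space UNIV)"
    using Y by (auto simp: poisson_process_def)
  define N where "N = distr M (count_space UNIV) Y"
  interpret N: prob_space N unfolding N_def by (rule prob_space_distr) measurable
  have ms: "measure N {y\<in>space N. P y} = measure M {\<omega>\<in>space M. P (Y \<omega>)}" for P
    unfolding N_def by (subst measure_distr) (auto intro!: arg_cong[where f = "measure M"])
  have "N.indep_vars (\<lambda>_. count_space UNIV) (\<lambda>A y. num_points A y) \<A>"
    if "finite \<A>" "\<A> \<subseteq> sets \<nu>" "disjoint \<A>" for \<A>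
  proof (cases "\<A> = {}")
    case True
    thus ?thesis by (simp add: N.indep_vars_def N.indep_sets_def)
  next
    case False
    have "indep_vars (\<lambda>_. count_space UNIV) (\<lambda>A \<omega>. num_points A (Y \<omega>)) \<A>"
      using Y that by (auto simp: poisson_process_def)
    hence *: "distr M (\<Pi>\<^sub>M i\<in>\<A>. count_space UNIV) (\<lambda>x. \<lambda>A\<in>\<A>. num_points A (Y x)) =
        (\<Pi>\<^sub>M A\<in>\<A>. distr M (count_space UNIV) (\<lambda>x. num_points A (Y x)))"
      by (subst (asm) indep_vars_iff_distr_eq_PiM'[OF False]) (auto intro: measurable_compose[OF Ym])
    have **: "measurable N L = space N \<rightarrow> space L" for L :: "'x measure"
      by (auto simp: N_def measurable_def)
    have 1: "distr N (\<Pi>\<^sub>M i\<in>\<A>. count_space UNIV) (\<lambda>x. \<lambda>A\<in>\<A>. num_points A x) =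
        distr M (\<Pi>\<^sub>M i\<in>\<A>. count_space UNIV) (\<lambda>x. \<lambda>A\<in>\<A>. num_points A (Y x))"
      unfolding N_def by (subst distr_distr) (auto simp: o_def space_PiM)
    have 2: "distr N (count_space UNIV) (\<lambda>x. num_points A x) =
        distr M (count_space UNIV) (\<lambda>x. num_points A (Y x))" for A
      unfolding N_def by (subst distr_distr) (auto simp: o_def)
    show ?thesis
      by (subst N.indep_vars_iff_distr_eq_PiM'[OF False]) (auto simp: ** 1 2 *)
  qed
  moreover have "AE y in N. set_mset y \<subseteq> space \<nu>"
    unfolding N_def by (subst AE_distr_iff) (use Y in \<open>auto simp: poisson_process_def\<close>)
  ultimately show ?thesis
    using Y N.prob_space_axioms ms unfolding N_def[symmetric] poisson_process_def
    by (auto simp: N_def)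
qed

lemma poisson_process_in_poisson_representable:
  fixes S :: "'a set" and M :: "'w measure"
  assumes S: "finite S" "sigma_finite_measure \<nu>" "space \<nu> = Pow S - {{}}"
    and sets: "sets \<nu> = Pow (Pow S - {{}})" and Y: "poisson_process M \<nu> Y"
  shows "\<exists>p\<in>poisson_representable S.
    measure_pmf p = distr M (count_space UNIV) (\<lambda>\<omega>. covered S (Y \<omega>))"
proof -
  interpret prob_space M using Y by (simp add: poisson_process_def)
  have Ym[measurable]: "Y \<in> measurable M (count_space UNIV)"
    and sub: "AE \<omega> in M. set_mset (Y \<omega>) \<subseteq> Pow S"
    using Y S by (auto simp: poisson_process_def)
  define N where "N = distr M (count_space UNIV) Y"
  define C where "C = {y. set_mset y \<subseteq> Pow S}"
  have N: "prob_space N" unfolding N_def by (rule prob_space_distr) measurable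
  interpret N: prob_space N by (rule N)
  have setsN [simp]: "sets N = UNIV" "space N = UNIV" by (auto simp: N_def)
  have countC: "countable C"
  proof -
    have "countable (mset ` lists (Pow S))"
      by (intro countable_image countable_lists countable_finite) (use S in auto)
    moreover have "C \<subseteq> mset ` lists (Pow S)"
    proof
      fix y assume "y \<in> C"
      moreover obtain xs where "y = mset xs" by (metis ex_mset)
      ultimately show "y \<in> mset ` lists (Pow S)" by (auto simp: C_def)
    qed
    ultimately show ?thesis by (rule countable_subset[rotated])
  qed
  have "AE y in N. y \<in> C"
    unfolding N_def by (subst AE_distr_iff) (use sub in \<open>auto simp: C_def\<close>)
  hence "AE y in N. measure N {y} \<noteq> 0"
    using N.AE_support_countable countC by auto
  then obtain Q where Q: "measure_pmf Q = N"
    using N by (metis (mono_tags, lifting) Abs_pmf_inverse mem_Collect_eq setsN(1))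
  have "poisson_process (measure_pmf Q) \<nu> (\<lambda>y. y)"
    unfolding Q N_def by (rule poisson_process_distr[OF Y])
  hence "map_pmf (covered S) Q \<in> poisson_representable S"
    using S sets unfolding poisson_representable_def by blast
  moreover have "measure_pmf (map_pmf (covered S) Q) =
      distr M (count_space UNIV) (\<lambda>\<omega>. covered S (Y \<omega>))"
    unfolding map_pmf_rep_eq Q N_def by (subst distr_distr) (auto simp: o_def)
  ultimately show ?thesis by metis
qed

definition poisson0 :: "real \<Rightarrow> nat pmf" where
  "poisson0 r = (if r = 0 then return_pmf 0 else poisson_pmf r)"

lemma pmf_poisson0: "r \<ge> 0 \<Longrightarrow> pmf (poisson0 r) k = r ^ k / fact k * exp (- r)"
  by (cases k) (auto simp: poisson0_def)

lemma poisson0_add: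
  assumes "r \<ge> 0" "s \<ge> 0"
  shows "map_pmf (\<lambda>(a, b). a + b) (pair_pmf (poisson0 r) (poisson0 s)) = poisson0 (r + s)"
proof (rule pmf_eqI)
  fix k :: nat
  have "pmf (map_pmf (\<lambda>(a, b). a + b) (pair_pmf (poisson0 r) (poisson0 s))) k =
     measure_pmf.prob (pair_pmf (poisson0 r) (poisson0 s)) ((\<lambda>i. (i, k - i)) ` {..k})"
    unfolding pmf_map by (rule arg_cong2[where f = measure]) (auto simp: image_iff)
  also have "\<dots> = (\<Sum>i\<le>k. pmf (poisson0 r) i * pmf (poisson0 s) (k - i))"
    by (subst measure_measure_pmf_finite) (auto simp: sum.reindex inj_on_def pmf_pair)
  also have "\<dots> = (\<Sum>i\<le>k. of_nat (k choose i) * r ^ i * s ^ (k - i)) / fact k * exp (- (r + s))"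
    unfolding sum_divide_distrib sum_distrib_right
    by (intro sum.cong refl)
       (use assms in \<open>simp add: pmf_poisson0 binomial_fact exp_diff exp_minus divide_simps\<close>)
  also have "\<dots> = pmf (poisson0 (r + s)) k"
    using assms by (simp add: pmf_poisson0 binomial_ring)
  finally show "pmf (map_pmf (\<lambda>(a, b). a + b) (pair_pmf (poisson0 r) (poisson0 s))) k =
    pmf (poisson0 (r + s)) k" .
qed

lemma sum_Pi_pmf_poisson0:
  assumes "finite A" "\<And>x. x \<in> A \<Longrightarrow> r x \<ge> 0"
  shows "map_pmf (\<lambda>f. \<Sum>x\<in>A. f x) (Pi_pmf A 0 (\<lambda>x. poisson0 (r x))) = poisson0 (\<Sum>x\<in>A. r x)"
  using assms
proof (induction A rule: finite_induct)
  case empty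
  thus ?case by (simp add: poisson0_def)
next
  case (insert x A)
  have *: "(\<Sum>z\<in>A. if z = x then a else b z) = (\<Sum>z\<in>A. b z)" for a :: nat and b
    using insert.hyps by (intro sum.cong) auto
  have "map_pmf (\<lambda>f. \<Sum>x\<in>insert x A. f x) (Pi_pmf (insert x A) 0 (\<lambda>x. poisson0 (r x))) =
     map_pmf (\<lambda>(a, b). a + b) (pair_pmf (poisson0 (r x))
        (map_pmf (\<lambda>f. \<Sum>x\<in>A. f x) (Pi_pmf A 0 (\<lambda>x. poisson0 (r x)))))"
    using insert.hyps
    by (simp add: Pi_pmf_insert pmf.map_comp o_def case_prod_unfold pair_map_pmf2 * fun_upd_def)
  also have "\<dots> = poisson0 (\<Sum>x\<in>insert x A. r x)"
    using insert by (simp add: poisson0_add sum_nonneg)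
  finally show ?case .
qed

lemma poisson_process_exists:
  fixes S :: "'a set"
  assumes S: "finite S" "sigma_finite_measure \<nu>" "space \<nu> = Pow S - {{}}"
    and sets: "sets \<nu> = Pow (Pow S - {{}})"
  shows "\<exists>Q. poisson_process (measure_pmf Q) \<nu> (\<lambda>y. y)"
proof -
  define E where "E = Pow S - {{}}"
  have E: "finite E" using S by (auto simp: E_def)
  have fin1: "emeasure \<nu> {B} \<noteq> \<infinity>" if "B \<in> E" for B
  proof -
    interpret sigma_finite_measure \<nu> by fact
    obtain F where F: "range F \<subseteq> sets \<nu>" "(\<Union>i. F i) = space \<nu>" "\<And>i :: nat. emeasure \<nu> (F i) \<noteq> \<infinity>"
      by (rule sigma_finite) blast
    have "B \<in> (\<Union>i. F i)" unfolding F(2) S(3) using that by (simp add: E_def)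
    then obtain i where "B \<in> F i" by blast
    hence "emeasure \<nu> {B} \<le> emeasure \<nu> (F i)" using F(1) by (intro emeasure_mono) auto
    thus ?thesis using F(3)[of i] by (auto simp: top_unique)
  qed
  have meas: "measure \<nu> A = (\<Sum>B\<in>A. measure \<nu> {B})" if "A \<subseteq> E" for A
  proof (rule measure_eq_sum_singleton)
    show "finite A" using that E by (rule finite_subset)
    show "{B} \<in> sets \<nu>" "emeasure \<nu> {B} \<noteq> \<infinity>" if "B \<in> A" for B
      using fin1[of B] sets that \<open>A \<subseteq> E\<close> by (auto simp: E_def)
  qed
  define P where "P = Pi_pmf E 0 (\<lambda>B. poisson0 (measure \<nu> {B}))"
  define y where "y = (\<lambda>f. \<Sum>B\<in>E. replicate_mset (f B) B)"
  have np: "num_points A (y f) = (\<Sum>B\<in>A. f B)" if "A \<subseteq> E" for A f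
  proof -
    have rep: "filter_mset Q (replicate_mset m B) = (if Q B then replicate_mset m B else {#})"
      for Q :: "'a set \<Rightarrow> bool" and m B
      by (induction m) auto
    have "num_points A (y f) = (\<Sum>B\<in>E. if B \<in> A then f B else 0)"
      unfolding y_def using E
      by (induction E rule: finite_induct) (auto simp: num_points_def rep)
    also have "\<dots> = (\<Sum>B\<in>A. f B)" using E that by (simp add: sum.If_cases Int_absorb1 Int_absorb2)
    finally show ?thesis .
  qed
  have sub: "set_mset (y f) \<subseteq> E" for f
    using E by (auto simp: y_def set_mset_sum split: if_splits)
  have law: "map_pmf (\<lambda>f. \<Sum>B\<in>A. f B) P = poisson0 (measure \<nu> A)" if "A \<subseteq> E" for A
  proof -
    have "map_pmf (\<lambda>f. \<Sum>B\<in>A. f B) P =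
      map_pmf (\<lambda>f. \<Sum>B\<in>A. f B) (Pi_pmf A 0 (\<lambda>B. poisson0 (measure \<nu> {B})))"
      unfolding P_def Pi_pmf_subset[OF E that] pmf.map_comp o_def
      by (intro map_pmf_cong refl sum.cong) auto
    also have "\<dots> = poisson0 (measure \<nu> A)"
      using that E by (subst sum_Pi_pmf_poisson0) (auto simp: meas[OF that] finite_subset)
    finally show ?thesis .
  qed
  have "poisson_process (measure_pmf P) \<nu> y"
    unfolding poisson_process_def
  proof (intro conjI ballI allI impI)
    fix A k assume "A \<in> sets \<nu>"
    hence A: "A \<subseteq> E" using sets by (auto simp: E_def)
    have "measure P {\<omega>\<in>space P. num_points A (y \<omega>) = k} =
        pmf (map_pmf (\<lambda>f. \<Sum>B\<in>A. f B) P) k"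
      unfolding pmf_map by (rule arg_cong2[where f = measure]) (auto simp: np[OF A])
    thus "measure P {\<omega>\<in>space P. num_points A (y \<omega>) = k} =
        measure \<nu> A ^ k / fact k * exp (- measure \<nu> A)"
      by (simp add: law[OF A] pmf_poisson0)
  next
    fix \<A> assume \<A>: "finite \<A> \<and> \<A> \<subseteq> sets \<nu> \<and> disjoint \<A>"
    have sub\<A>: "A \<subseteq> E" if "A \<in> \<A>" for A using that \<A> sets by (auto simp: E_def)
    have "prob_space.indep_vars (measure_pmf P) (\<lambda>A. PiM A (\<lambda>_. count_space UNIV))
        (\<lambda>A f. restrict f A) \<A>"
      unfolding P_def
      by (rule prob_space.indep_vars_restrict[OF measure_pmf.prob_space_axioms
            indep_vars_Pi_pmf[OF E]])
         (use sub\<A> \<A> in \<open>auto simp: disjoint_family_on_def dest: disjointD\<close>)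
    hence "prob_space.indep_vars (measure_pmf P) (\<lambda>_. count_space UNIV)
        (\<lambda>A f. \<Sum>B\<in>A. restrict f A B) \<A>"
      by (rule prob_space.indep_vars_compose2[OF measure_pmf.prob_space_axioms])
         (use sub\<A> E in \<open>auto simp: count_space_PiM_finite finite_subset\<close>)
    thus "prob_space.indep_vars (measure_pmf P) (\<lambda>_. count_space UNIV) (\<lambda>A \<omega>. num_points A (y \<omega>)) \<A>"
      by (subst prob_space.indep_vars_cong[OF measure_pmf.prob_space_axioms refl _ refl, where
          Y = "\<lambda>A f. \<Sum>B\<in>A. restrict f A B"])
         (auto simp: np sub\<A>)
  qed (use sub S in \<open>auto simp: E_def measure_pmf.prob_space_axioms\<close>)
  hence "poisson_process (measure_pmf (map_pmf y P)) \<nu> (\<lambda>y. y)"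
    unfolding map_pmf_rep_eq by (rule poisson_process_distr)
  thus ?thesis by blast
qed

end

theory Submission
  imports Defs
begin

text \<open>
  The weight of a configuration with magnetization \<open>m\<close> is proportional to \<open>exp (n \<beta> m\<^sup>2 / 2)\<close>.
  Linearising the square shows that \<open>m\<close> concentrates on the maximizers \<open>\<plusminus>c\<close> of
  \<open>ln (2 cosh (\<beta> t)) - \<beta> t\<^sup>2 / 2\<close>, which solve \<open>tanh (\<beta> t) = t\<close>; hence the critical value is \<open>1\<close>.
  For \<open>\<beta> > 1\<close> the probability that \<open>k\<close> given coordinates of \<open>X\<^sub>n\<close> vanish therefore tends to
  \<open>(p\<^sup>k + (1 - p)\<^sup>k) / 2\<close> with \<open>p = (1 + c) / 2\<close>. If \<open>X\<^sub>n\<close> were Poisson representable, then the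
  iterated differences of the logarithms of these probabilities would be intensities, hence
  nonnegative. In the limit these are the differences of \<open>ln (1 + r\<^sup>k)\<close> with \<open>r = (1 - p) / p\<close>, and
  this sequence is not completely monotone: its representing signed measure has a negative atom
  at \<open>r\<^sup>2\<close>.
\<close>

section \<open>Concentration of the magnetization\<close>

lemma sum_pairs_eq:
  fixes f :: "nat \<Rightarrow> real"
  shows "(\<Sum>(i, j) \<in> {(i, j). 1 \<le> i \<and> i < j \<and> j \<le> n}. f i * f j) =
    ((\<Sum>i=1..n. f i)\<^sup>2 - (\<Sum>i=1..n. (f i)\<^sup>2)) / 2"
proof (induction n)
  case 0
  have "{(i, j). 1 \<le> i \<and> i < j \<and> j \<le> (0::nat)} = {}" by auto
  thus ?case by (simp only: sum.empty) simp
next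
  case (Suc n)
  have fin: "finite {(i, j). 1 \<le> i \<and> i < j \<and> j \<le> n}"
    by (rule finite_subset[of _ "{1..n} \<times> {1..n}"]) auto
  have split: "{(i, j). 1 \<le> i \<and> i < j \<and> j \<le> Suc n} =
      {(i, j). 1 \<le> i \<and> i < j \<and> j \<le> n} \<union> (\<lambda>i. (i, Suc n)) ` {1..n}"
    by (auto simp: le_Suc_eq)
  have "(\<Sum>(i, j) \<in> {(i, j). 1 \<le> i \<and> i < j \<and> j \<le> Suc n}. f i * f j) =
      (\<Sum>(i, j) \<in> {(i, j). 1 \<le> i \<and> i < j \<and> j \<le> n}. f i * f j) + (\<Sum>i=1..n. f i * f (Suc n))"
    unfolding split by (subst sum.union_disjoint) (use fin in \<open>auto simp: sum.reindex inj_on_def\<close>)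
  thus ?case
    unfolding Suc sum_distrib_right[symmetric]
    by (simp add: power2_eq_square field_simps del: One_nat_def)
qed

lemma spin_configs_square: "\<sigma> \<in> spin_configs n \<Longrightarrow> i \<in> {1..n} \<Longrightarrow> (\<sigma> i)\<^sup>2 = 1"
  by (auto simp: spin_configs_def dest!: PiE_mem)

lemma sum_spins_eq_magnetization: "(\<Sum>i=1..n. \<sigma> i) = real n * magnetization n \<sigma>"
  by (cases "n = 0") (auto simp: magnetization_def)

lemma cw_weight_eq:
  assumes "\<sigma> \<in> spin_configs n" "n > 0"
  shows "cw_weight n (\<beta> / real n) \<sigma> =
    exp (- \<beta> / 2) * exp (real n * (\<beta> * (magnetization n \<sigma>)\<^sup>2 / 2))"
proof -
  have "(\<Sum>i=1..n. (\<sigma> i)\<^sup>2) = (\<Sum>i=1..n. 1)"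
    by (intro sum.cong refl spin_configs_square[OF assms(1)])
  hence "(\<Sum>i=1..n. (\<sigma> i)\<^sup>2) = real n" by simp
  thus ?thesis
    unfolding cw_weight_def sum_pairs_eq exp_add[symmetric]
    using assms(2) unfolding sum_spins_eq_magnetization[of \<sigma>]
    by (intro arg_cong[where f = exp]) (simp add: field_simps power2_eq_square)
qed

lemma cw_weight_pos: "cw_weight n J \<sigma> > 0"
  by (simp add: cw_weight_def)

lemma magnetization_bounds:
  assumes "\<sigma> \<in> spin_configs n"
  shows "\<bar>magnetization n \<sigma>\<bar> \<le> 1"
proof -
  have "\<bar>\<Sum>i=1..n. \<sigma> i\<bar> \<le> (\<Sum>i=1..n. \<bar>\<sigma> i\<bar>)" by (rule sum_abs)
  also have "\<dots> \<le> (\<Sum>i=1..n. 1)"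
    using spin_configs_square[OF assms] by (intro sum_mono) (simp add: abs_square_eq_1 flip: abs_square_le_1)
  finally show ?thesis
    by (cases "n = 0") (auto simp: magnetization_def divide_simps)
qed

lemma set_pmf_curie_weiss: "set_pmf (curie_weiss n J) = spin_configs n"
  using cw_partition_pos[of n J]
  by (auto simp: set_pmf_eq pmf_curie_weiss less_imp_neq[OF cw_weight_pos, symmetric])

lemma expectation_curie_weiss:
  fixes f :: "(nat \<Rightarrow> real) \<Rightarrow> real"
  shows "measure_pmf.expectation (curie_weiss n J) f =
    (\<Sum>\<sigma>\<in>spin_configs n. cw_weight n J \<sigma> / cw_partition n J * f \<sigma>)"
  by (subst integral_measure_pmf_real[OF finite_spin_configs])
     (auto simp: set_pmf_curie_weiss pmf_curie_weiss mult.commute)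

lemma prob_curie_weiss:
  "measure_pmf.prob (curie_weiss n J) A =
    (\<Sum>\<sigma>\<in>spin_configs n \<inter> A. cw_weight n J \<sigma>) / cw_partition n J"
proof -
  have "measure_pmf.prob (curie_weiss n J) A = measure_pmf.prob (curie_weiss n J) (spin_configs n \<inter> A)"
    using measure_Int_set_pmf[of "curie_weiss n J" A] by (simp add: set_pmf_curie_weiss Int_commute)
  thus ?thesis
    by (simp add: measure_measure_pmf_finite finite_spin_configs pmf_curie_weiss sum_divide_distrib)
qed

lemma integrable_curie_weiss [simp]: "integrable (curie_weiss n J) (f :: _ \<Rightarrow> real)"
  by (rule integrable_measure_pmf_finite) (simp add: set_pmf_curie_weiss finite_spin_configs)

lemma sum_exp_spins:
  "(\<Sum>\<sigma>\<in>spin_configs n. exp (\<theta> * (\<Sum>i=1..n. \<sigma> i))) = (2 * cosh \<theta>) ^ n" for \<theta> :: real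
proof -
  have "(\<Sum>\<sigma>\<in>spin_configs n. exp (\<theta> * (\<Sum>i=1..n. \<sigma> i))) =
      (\<Sum>\<sigma>\<in>spin_configs n. \<Prod>i=1..n. exp (\<theta> * \<sigma> i))"
    by (simp add: sum_distrib_left exp_sum)
  also have "\<dots> = (\<Prod>i=1..n. \<Sum>s\<in>{-1, 1}. exp (\<theta> * s))"
    unfolding spin_configs_def by (subst prod_sum_PiE) auto
  also have "(\<Sum>s\<in>{-1, 1}. exp (\<theta> * s)) = 2 * cosh \<theta>"
    by (simp add: cosh_field_def)
  also have "(\<Prod>i=1..n. 2 * cosh \<theta>) = (2 * cosh \<theta>) ^ n" by simp
  finally show ?thesis .
qed

definition cw_rate :: "real \<Rightarrow> real \<Rightarrow> real" where
  "cw_rate \<beta> t = ln (2 * cosh (\<beta> * t)) - \<beta> * t\<^sup>2 / 2"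

lemma sum_tilted_spins:
  assumes "n > 0"
  shows "(\<Sum>\<sigma>\<in>spin_configs n. exp (real n * (\<beta> * t * magnetization n \<sigma> - \<beta> * t\<^sup>2 / 2))) =
    exp (real n * cw_rate \<beta> t)"
proof -
  have "(\<Sum>\<sigma>\<in>spin_configs n. exp (real n * (\<beta> * t * magnetization n \<sigma> - \<beta> * t\<^sup>2 / 2))) =
      (\<Sum>\<sigma>\<in>spin_configs n. exp (\<beta> * t * (\<Sum>i=1..n. \<sigma> i))) * exp (- (real n * (\<beta> * t\<^sup>2 / 2)))"
    unfolding sum_distrib_right sum_spins_eq_magnetization
    by (intro sum.cong refl) (simp add: exp_add[symmetric] algebra_simps)
  also have "\<dots> = exp (real n * cw_rate \<beta> t)"
  proof -
    have "exp (real n * ln (2 * cosh (\<beta> * t))) = (2 * cosh (\<beta> * t)) ^ n"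
      by (simp add: exp_of_nat_mult)
    moreover have "exp (real n * cw_rate \<beta> t) =
        exp (real n * ln (2 * cosh (\<beta> * t))) * exp (- (real n * (\<beta> * t\<^sup>2 / 2)))"
      unfolding cw_rate_def exp_add[symmetric] by (simp add: algebra_simps)
    ultimately show ?thesis by (simp only: sum_exp_spins)
  qed
  finally show ?thesis .
qed

text \<open>This bound and the next linearise the square by \<open>m\<^sup>2 = 2 t m - t\<^sup>2 + (m - t)\<^sup>2\<close>, which leads to
  product measures.\<close>

lemma cw_partition_ge:
  assumes "n > 0" "\<beta> \<ge> 0"
  shows "exp (- \<beta> / 2) * exp (real n * cw_rate \<beta> t) \<le> cw_partition n (\<beta> / real n)"
  unfolding cw_partition_def sum_tilted_spins[OF assms(1), symmetric] sum_distrib_left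
proof (rule sum_mono)
  fix \<sigma> assume \<sigma>: "\<sigma> \<in> spin_configs n"
  have "\<beta> * (t - magnetization n \<sigma>)\<^sup>2 \<ge> 0" using assms by simp
  hence "\<beta> * t * magnetization n \<sigma> - \<beta> * t\<^sup>2 / 2 \<le> \<beta> * (magnetization n \<sigma>)\<^sup>2 / 2"
    by (simp add: power2_eq_square algebra_simps)
  thus "exp (- \<beta> / 2) * exp (real n * (\<beta> * t * magnetization n \<sigma> - \<beta> * t\<^sup>2 / 2))
      \<le> cw_weight n (\<beta> / real n) \<sigma>"
    unfolding cw_weight_eq[OF \<sigma> assms(1)]
    by (intro mult_left_mono iffD2[OF exp_le_cancel_iff]) auto
qed

lemma sum_cw_weight_ball_le:
  assumes "n > 0" "\<beta> \<ge> 0"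
  shows "(\<Sum>\<sigma>\<in>spin_configs n \<inter> {\<sigma>. dist u (magnetization n \<sigma>) < \<delta>}. cw_weight n (\<beta> / real n) \<sigma>)
    \<le> exp (- \<beta> / 2) * exp (real n * (cw_rate \<beta> u + \<beta> * \<delta>\<^sup>2 / 2))"
proof -
  have le: "cw_weight n (\<beta> / real n) \<sigma> \<le> exp (- \<beta> / 2) * (exp (real n * (\<beta> * \<delta>\<^sup>2 / 2)) *
      exp (real n * (\<beta> * u * magnetization n \<sigma> - \<beta> * u\<^sup>2 / 2)))"
    if "\<sigma> \<in> spin_configs n \<inter> {\<sigma>. dist u (magnetization n \<sigma>) < \<delta>}" for \<sigma>
  proof -
    have \<sigma>: "\<sigma> \<in> spin_configs n" and "\<bar>u - magnetization n \<sigma>\<bar> \<le> \<delta>"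
      using that by (auto simp: dist_real_def)
    hence "(u - magnetization n \<sigma>)\<^sup>2 \<le> \<delta>\<^sup>2" by (auto simp: abs_le_square_iff[symmetric])
    hence "\<beta> * (u - magnetization n \<sigma>)\<^sup>2 \<le> \<beta> * \<delta>\<^sup>2" using assms by (intro mult_left_mono)
    hence "\<beta> * (magnetization n \<sigma>)\<^sup>2 / 2 \<le>
        \<beta> * \<delta>\<^sup>2 / 2 + (\<beta> * u * magnetization n \<sigma> - \<beta> * u\<^sup>2 / 2)"
      by (simp add: power2_eq_square algebra_simps)
    thus ?thesis
      unfolding cw_weight_eq[OF \<sigma> assms(1)] exp_add[symmetric] distrib_left[symmetric]
      by (intro add_left_mono mult_left_mono iffD2[OF exp_le_cancel_iff]) auto
  qed
  have "(\<Sum>\<sigma>\<in>spin_configs n \<inter> {\<sigma>. dist u (magnetization n \<sigma>) < \<delta>}. cw_weight n (\<beta> / real n) \<sigma>) \<le>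
    (\<Sum>\<sigma>\<in>spin_configs n \<inter> {\<sigma>. dist u (magnetization n \<sigma>) < \<delta>}.
      exp (- \<beta> / 2) * (exp (real n * (\<beta> * \<delta>\<^sup>2 / 2)) *
      exp (real n * (\<beta> * u * magnetization n \<sigma> - \<beta> * u\<^sup>2 / 2))))"
    by (intro sum_mono le)
  also have "\<dots> \<le> (\<Sum>\<sigma>\<in>spin_configs n. exp (- \<beta> / 2) * (exp (real n * (\<beta> * \<delta>\<^sup>2 / 2)) *
      exp (real n * (\<beta> * u * magnetization n \<sigma> - \<beta> * u\<^sup>2 / 2))))"
    by (intro sum_mono2 finite_spin_configs) auto
  also have "\<dots> = exp (- \<beta> / 2) * exp (real n * (cw_rate \<beta> u + \<beta> * \<delta>\<^sup>2 / 2))"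
    unfolding sum_distrib_left[symmetric] sum_tilted_spins[OF assms(1)]
    by (simp add: exp_add[symmetric] algebra_simps)
  finally show ?thesis .
qed

lemma prob_magnetization_ball_le:
  assumes "n > 0" "\<beta> \<ge> 0"
  shows "measure_pmf.prob (curie_weiss n (\<beta> / real n)) {\<sigma>. dist u (magnetization n \<sigma>) < \<delta>}
    \<le> exp (real n * (cw_rate \<beta> u - cw_rate \<beta> t + \<beta> * \<delta>\<^sup>2 / 2))"
proof -
  have "measure_pmf.prob (curie_weiss n (\<beta> / real n)) {\<sigma>. dist u (magnetization n \<sigma>) < \<delta>} \<le>
     (exp (- \<beta> / 2) * exp (real n * (cw_rate \<beta> u + \<beta> * \<delta>\<^sup>2 / 2))) /
     (exp (- \<beta> / 2) * exp (real n * cw_rate \<beta> t))"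
    unfolding prob_curie_weiss
    by (intro frac_le sum_cw_weight_ball_le cw_partition_ge assms) auto
  also have "\<dots> = exp (real n * (cw_rate \<beta> u - cw_rate \<beta> t + \<beta> * \<delta>\<^sup>2 / 2))"
    by (simp add: exp_diff[symmetric] algebra_simps)
  finally show ?thesis .
qed

lemma concentrates_at_unique_maximizer:
  assumes "\<beta> > 0"
    and max: "\<And>t. \<bar>t\<bar> \<le> 1 \<Longrightarrow> \<bar>t\<bar> \<noteq> c \<Longrightarrow> cw_rate \<beta> t < cw_rate \<beta> c"
  shows "concentrates_at \<beta> c"
  unfolding concentrates_at_def
proof (intro allI impI)
  fix \<epsilon> :: real assume \<epsilon>: "\<epsilon> > 0"
  let ?P = "\<lambda>n. measure_pmf.prob (curie_weiss n (\<beta> / real n))"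
  define K where "K = {-1..1} \<inter> {u. \<bar>\<bar>u\<bar> - c\<bar> \<ge> \<epsilon>}"
  have "compact K" unfolding K_def
    by (intro compact_Int_closed closed_Collect_le continuous_intros) auto
  have cont: "continuous_on K (cw_rate \<beta>)"
    unfolding cw_rate_def
    by (intro continuous_intros) (use cosh_real_pos in \<open>auto simp: less_imp_neq[symmetric]\<close>)
  obtain \<gamma> where \<gamma>: "\<gamma> > 0" "\<And>u. u \<in> K \<Longrightarrow> cw_rate \<beta> u - cw_rate \<beta> c \<le> - 2 * \<gamma>"
  proof (cases "K = {}")
    case True
    thus ?thesis using that[of 1] by auto
  next
    case False
    then obtain v where v: "v \<in> K" "\<And>u. u \<in> K \<Longrightarrow> cw_rate \<beta> u \<le> cw_rate \<beta> v"
      using continuous_attains_sup[OF \<open>compact K\<close> _ cont] by auto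
    have "cw_rate \<beta> v < cw_rate \<beta> c" using v(1) \<epsilon> by (intro max) (auto simp: K_def)
    thus ?thesis using v by (intro that[of "(cw_rate \<beta> c - cw_rate \<beta> v) / 2"]) auto
  qed
  define \<delta> where "\<delta> = sqrt (2 * \<gamma> / \<beta>)"
  have \<delta>: "\<delta> > 0" "\<beta> * \<delta>\<^sup>2 / 2 = \<gamma>" using \<gamma> assms by (auto simp: \<delta>_def)
  obtain U where U: "finite U" "U \<subseteq> K" "K \<subseteq> (\<Union>u\<in>U. ball u \<delta>)"
  proof (rule compactE_image[OF \<open>compact K\<close>, of K "\<lambda>u. ball u \<delta>"])
    show "K \<subseteq> (\<Union>u\<in>K. ball u \<delta>)" using \<delta>(1) by auto
  qed (use that in auto)
  have le: "?P n {\<sigma>. \<epsilon> < \<bar>\<bar>magnetization n \<sigma>\<bar> - c\<bar>} \<le> real (card U) * exp (- \<gamma>) ^ n" if "n > 0" for n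
  proof -
    have "?P n {\<sigma>. \<epsilon> < \<bar>\<bar>magnetization n \<sigma>\<bar> - c\<bar>} =
        ?P n ({\<sigma>. \<epsilon> < \<bar>\<bar>magnetization n \<sigma>\<bar> - c\<bar>} \<inter> spin_configs n)"
      using measure_Int_set_pmf[of "curie_weiss n (\<beta> / real n)"] by (simp add: set_pmf_curie_weiss)
    also have "\<dots> \<le> ?P n (\<Union>u\<in>U. {\<sigma>. dist u (magnetization n \<sigma>) < \<delta>})"
    proof (intro measure_pmf.finite_measure_mono subsetI)
      fix \<sigma> assume "\<sigma> \<in> {\<sigma>. \<epsilon> < \<bar>\<bar>magnetization n \<sigma>\<bar> - c\<bar>} \<inter> spin_configs n"
      hence "magnetization n \<sigma> \<in> K" using magnetization_bounds[of \<sigma> n] by (auto simp: K_def abs_le_iff)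
      thus "\<sigma> \<in> (\<Union>u\<in>U. {\<sigma>. dist u (magnetization n \<sigma>) < \<delta>})"
        using subsetD[OF U(3)] by (auto simp: mem_ball)
    qed auto
    also have "\<dots> \<le> (\<Sum>u\<in>U. ?P n {\<sigma>. dist u (magnetization n \<sigma>) < \<delta>})"
      by (rule measure_pmf.finite_measure_subadditive_finite) (use U in auto)
    also have "\<dots> \<le> (\<Sum>u\<in>U. exp (- \<gamma>) ^ n)"
    proof (rule sum_mono)
      fix u assume "u \<in> U"
      hence "real n * (cw_rate \<beta> u - cw_rate \<beta> c + \<beta> * \<delta>\<^sup>2 / 2) \<le> real n * (- \<gamma>)"
        using \<gamma>(2)[of u] U(2) unfolding \<delta>(2) by (intro mult_left_mono) auto
      hence "exp (real n * (cw_rate \<beta> u - cw_rate \<beta> c + \<beta> * \<delta>\<^sup>2 / 2)) \<le> exp (- \<gamma>) ^ n"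
        by (simp add: exp_of_nat_mult[symmetric])
      thus "?P n {\<sigma>. dist u (magnetization n \<sigma>) < \<delta>} \<le> exp (- \<gamma>) ^ n"
        using prob_magnetization_ball_le[of n \<beta> u \<delta> c] that assms(1) by simp
    qed
    finally show ?thesis by simp
  qed
  have "(\<lambda>n. real (card U) * exp (- \<gamma>) ^ n) \<longlonglongrightarrow> real (card U) * 0"
    by (intro tendsto_mult LIMSEQ_realpow_zero tendsto_const) (use \<gamma> in auto)
  hence lim: "(\<lambda>n. real (card U) * exp (- \<gamma>) ^ n) \<longlonglongrightarrow> 0" by simp
  show "(\<lambda>n. ?P n {\<sigma>. \<epsilon> < \<bar>\<bar>magnetization n \<sigma>\<bar> - c\<bar>}) \<longlonglongrightarrow> 0"
  proof (rule tendsto_sandwich[OF _ _ tendsto_const lim])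
    show "\<forall>\<^sub>F n in sequentially. ?P n {\<sigma>. \<epsilon> < \<bar>\<bar>magnetization n \<sigma>\<bar> - c\<bar>} \<le> real (card U) * exp (- \<gamma>) ^ n"
      using eventually_gt_at_top[of 0] by eventually_elim (rule le)
  qed auto
qed

section \<open>The critical value\<close>

lemma cw_rate_deriv: "(cw_rate \<beta> has_real_derivative \<beta> * (tanh (\<beta> * t) - t)) (at t)"
proof -
  have "cosh (\<beta> * t) > 0" by (rule cosh_real_pos)
  thus ?thesis
    unfolding cw_rate_def
    by (auto intro!: derivative_eq_intros simp: tanh_def field_simps)
qed

lemma cw_rate_minus: "cw_rate \<beta> (- t) = cw_rate \<beta> t"
  by (simp add: cw_rate_def)

lemma cw_rate_less_max:
  assumes "\<beta> > 0" "c \<ge> 0"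
    and pos: "\<And>t. 0 < t \<Longrightarrow> t < c \<Longrightarrow> tanh (\<beta> * t) > t"
    and neg: "\<And>t. c < t \<Longrightarrow> tanh (\<beta> * t) < t"
    and "\<bar>t\<bar> \<noteq> c"
  shows "cw_rate \<beta> t < cw_rate \<beta> c"
proof -
  have cont: "continuous_on A (cw_rate \<beta>)" for A
    by (intro continuous_at_imp_continuous_on ballI DERIV_isCont) (rule cw_rate_deriv)
  have "cw_rate \<beta> \<bar>t\<bar> < cw_rate \<beta> c"
  proof (cases "\<bar>t\<bar> < c")
    case True
    show ?thesis
    proof (rule DERIV_pos_imp_increasing_open[OF True _ cont])
      fix x assume "\<bar>t\<bar> < x" "x < c"
      hence "\<beta> * (tanh (\<beta> * x) - x) > 0" using pos[of x] assms(1) by simp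
      thus "\<exists>y. DERIV (cw_rate \<beta>) x :> y \<and> y > 0" using cw_rate_deriv by blast
    qed
  next
    case False
    hence "c < \<bar>t\<bar>" using assms by simp
    thus ?thesis
    proof (rule DERIV_neg_imp_decreasing_open[OF _ _ cont])
      fix x assume "c < x" "x < \<bar>t\<bar>"
      hence "\<beta> * (tanh (\<beta> * x) - x) < 0" using neg[of x] assms(1) by (simp add: mult_less_0_iff)
      thus "\<exists>y. DERIV (cw_rate \<beta>) x :> y \<and> y < 0" using cw_rate_deriv by blast
    qed
  qed
  thus ?thesis by (cases "t \<ge> 0") (auto simp: cw_rate_minus)
qed

lemma mean_field_equation_deriv:
  "((\<lambda>t. tanh (\<beta> * t) - t) has_real_derivative \<beta> * (1 - (tanh (\<beta> * t))\<^sup>2) - 1) (at t)"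
  for \<beta> t :: real
  by (auto intro!: derivative_eq_intros)

lemma tanh_less_self:
  assumes "t > 0"
  shows "tanh t < (t :: real)"
proof -
  have "(\<lambda>t. tanh (1 * t) - t) t < (\<lambda>t. tanh (1 * t) - t) (0 :: real)"
  proof (rule DERIV_neg_imp_decreasing_open[OF assms])
    fix x :: real assume "0 < x"
    hence "1 * (1 - (tanh (1 * x))\<^sup>2) - 1 < 0" by simp
    thus "\<exists>y. ((\<lambda>t. tanh (1 * t) - t) has_real_derivative y) (at x) \<and> y < 0"
      using mean_field_equation_deriv[of 1 x] by blast
  qed (auto intro!: continuous_intros)
  thus ?thesis by simp
qed

lemma mean_field_solution:
  fixes \<beta> :: real
  assumes "\<beta> > 1"
  obtains c where "0 < c" "c < 1"
    "\<And>t. 0 < t \<Longrightarrow> t < c \<Longrightarrow> tanh (\<beta> * t) > t" "\<And>t. c < t \<Longrightarrow> tanh (\<beta> * t) < t"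
proof -
  define g where "g = (\<lambda>t. tanh (\<beta> * t) - t)"
  have deriv: "(g has_real_derivative \<beta> * (1 - (tanh (\<beta> * t))\<^sup>2) - 1) (at t)" for t
    unfolding g_def by (rule mean_field_equation_deriv)
  have cont: "continuous_on A g" for A unfolding g_def by (intro continuous_intros) auto
  have g0: "g 0 = 0" by (simp add: g_def)
  have g_ge: "g t < 0" if "t \<ge> 1" for t using tanh_real_lt_1[of "\<beta> * t"] that by (simp add: g_def)
  have uniq: False if ab: "0 < a" "a < b" "g a = 0" "g b = 0" for a b
  proof -
    obtain x where x: "0 < x" "x < a" "\<beta> * (1 - (tanh (\<beta> * x))\<^sup>2) - 1 = 0"
      using MVT2[of 0 a g "\<lambda>t. \<beta> * (1 - (tanh (\<beta> * t))\<^sup>2) - 1"] deriv ab g0 by auto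
    obtain y where y: "a < y" "y < b" "\<beta> * (1 - (tanh (\<beta> * y))\<^sup>2) - 1 = 0"
      using MVT2[of a b g "\<lambda>t. \<beta> * (1 - (tanh (\<beta> * t))\<^sup>2) - 1"] deriv ab by auto
    have "\<beta> * (1 - (tanh (\<beta> * x))\<^sup>2) = \<beta> * (1 - (tanh (\<beta> * y))\<^sup>2)" using x y by simp
    hence "(tanh (\<beta> * x))\<^sup>2 = (tanh (\<beta> * y))\<^sup>2" using assms by simp
    moreover have "tanh (\<beta> * x) \<ge> 0" "tanh (\<beta> * y) \<ge> 0" using x y assms that by auto
    ultimately have "tanh (\<beta> * x) = tanh (\<beta> * y)" by (simp add: power2_eq_iff_nonneg)
    thus False using x y assms by simp
  qed
  obtain d where d: "d > 0" "\<And>h. 0 < h \<Longrightarrow> h < d \<Longrightarrow> g h > 0"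
    using DERIV_pos_inc_right[OF deriv[of 0]] assms g0 by auto
  define a where "a = min (d / 2) (1 / 2)"
  have a: "0 < a" "a < 1" "g a > 0" using d(1) d(2)[of a] by (auto simp: a_def min_def)
  obtain c where c: "a \<le> c" "c \<le> 1" "g c = 0"
    using IVT2'[of g 1 0 a] a g_ge[of 1] cont by force
  have "c \<noteq> 1" using c g_ge[of 1] by auto
  hence c': "0 < c" "c < 1" using a c by auto
  have pos: "g t > 0" if "0 < t" "t < c" for t
  proof (rule ccontr)
    assume "\<not> g t > 0"
    define b where "b = min (d / 2) (t / 2)"
    have b: "0 < b" "b < t" "g b > 0" using d(1) d(2)[of b] that by (auto simp: b_def min_def)
    obtain s where "b \<le> s" "s \<le> t" "g s = 0"
      using IVT2'[of g t 0 b] b \<open>\<not> g t > 0\<close> cont by force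
    thus False using uniq[of s c] b that c by simp
  qed
  have neg: "g t < 0" if "c < t" for t
  proof (rule ccontr)
    assume "\<not> g t < 0"
    moreover from this have "t < 1" using g_ge[of t] by force
    ultimately obtain s where "t \<le> s" "s \<le> 1" "g s = 0"
      using IVT2'[of g 1 0 t] g_ge[of 1] cont by force
    thus False using uniq[of c s] that c c' by simp
  qed
  show ?thesis using that[of c] c' pos neg by (simp add: g_def)
qed

lemma concentrates_at_above_one:
  assumes "\<beta> > 1"
  shows "\<exists>c. 0 < c \<and> c < 1 \<and> concentrates_at \<beta> c"
proof -
  obtain c where c: "0 < c" "c < 1"
    "\<And>t. 0 < t \<Longrightarrow> t < c \<Longrightarrow> tanh (\<beta> * t) > t" "\<And>t. c < t \<Longrightarrow> tanh (\<beta> * t) < t"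
    using mean_field_solution[OF assms] by blast
  have "concentrates_at \<beta> c"
    by (intro concentrates_at_unique_maximizer cw_rate_less_max) (use assms c in auto)
  thus ?thesis using c by blast
qed

lemma concentrates_at_one: "concentrates_at 1 0"
  by (intro concentrates_at_unique_maximizer cw_rate_less_max) (simp_all add: tanh_less_self)

text \<open>The likelihood ratio between the models at \<open>\<beta> \<le> 1\<close> and at \<open>1\<close> is decreasing in the absolute
  magnetization.\<close>

lemma prob_magnetization_le_critical:
  assumes "\<beta> \<le> 1" "n > 0" "\<epsilon> > 0"
  shows "measure_pmf.prob (curie_weiss n (\<beta> / real n)) {\<sigma>. \<bar>magnetization n \<sigma>\<bar> > \<epsilon>}
    \<le> measure_pmf.prob (curie_weiss n (1 / real n)) {\<sigma>. \<bar>magnetization n \<sigma>\<bar> > \<epsilon>}"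
proof -
  define A where "A = spin_configs n \<inter> {\<sigma>. \<bar>magnetization n \<sigma>\<bar> > \<epsilon>}"
  define B where "B = spin_configs n - A"
  define w where "w = (\<lambda>\<beta>. cw_weight n (\<beta> / real n))"
  define \<kappa> where "\<kappa> = exp ((1 - \<beta>) / 2 - real n * (1 - \<beta>) * \<epsilon>\<^sup>2 / 2)"
  have w_pos: "w \<gamma> \<sigma> > 0" for \<gamma> \<sigma> unfolding w_def by (rule cw_weight_pos)
  have ratio: "w \<beta> \<sigma> = exp ((1 - \<beta>) / 2 - real n * (1 - \<beta>) * (magnetization n \<sigma>)\<^sup>2 / 2) * w 1 \<sigma>"
    if "\<sigma> \<in> spin_configs n" for \<sigma>
  proof -
    have "- \<beta> / 2 + N * (\<beta> * M / 2) = (1 - \<beta>) / 2 - N * (1 - \<beta>) * M / 2 + (- 1 / 2 + N * (1 * M / 2))"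
      for N M :: real
      by (simp add: algebra_simps diff_divide_distrib add_divide_distrib)
    thus ?thesis
      unfolding w_def cw_weight_eq[OF that assms(2)] exp_add[symmetric] by simp
  qed
  have exp_mono: "real n * (1 - \<beta>) * x \<le> real n * (1 - \<beta>) * y" if "x \<le> y" for x y
    using assms that by (intro mult_left_mono) auto
  have leA: "w \<beta> \<sigma> \<le> \<kappa> * w 1 \<sigma>" if "\<sigma> \<in> A" for \<sigma>
  proof -
    have "\<epsilon>\<^sup>2 \<le> (magnetization n \<sigma>)\<^sup>2"
      using that assms(3) by (auto simp: A_def simp flip: abs_le_square_iff)
    thus ?thesis
      using that exp_mono[of "\<epsilon>\<^sup>2" "(magnetization n \<sigma>)\<^sup>2"]
      by (auto simp: A_def ratio \<kappa>_def intro!: mult_right_mono less_imp_le[OF w_pos])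
  qed
  have geB: "\<kappa> * w 1 \<sigma> \<le> w \<beta> \<sigma>" if "\<sigma> \<in> B" for \<sigma>
  proof -
    have "(magnetization n \<sigma>)\<^sup>2 \<le> \<epsilon>\<^sup>2"
      using that assms(3) by (auto simp: A_def B_def simp flip: abs_le_square_iff)
    thus ?thesis
      using that exp_mono[of "(magnetization n \<sigma>)\<^sup>2" "\<epsilon>\<^sup>2"]
      by (auto simp: B_def ratio \<kappa>_def intro!: mult_right_mono less_imp_le[OF w_pos])
  qed
  define a where "a = (\<lambda>\<beta>. sum (w \<beta>) A)"
  define b where "b = (\<lambda>\<beta>. sum (w \<beta>) B)"
  have nonneg: "a \<gamma> \<ge> 0" "b \<gamma> \<ge> 0" for \<gamma>
    unfolding a_def b_def by (auto intro!: sum_nonneg less_imp_le[OF w_pos])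
  have Z: "cw_partition n (\<gamma> / real n) = a \<gamma> + b \<gamma>" for \<gamma>
    unfolding cw_partition_def a_def b_def B_def w_def
    using sum.subset_diff[of A "spin_configs n" "cw_weight n (\<gamma> / real n)"] finite_spin_configs
    by (simp add: A_def add.commute)
  have Zpos: "a \<gamma> + b \<gamma> > 0" for \<gamma> using cw_partition_pos[of n "\<gamma> / real n"] by (simp add: Z)
  have "a \<beta> \<le> \<kappa> * a 1" unfolding a_def sum_distrib_left by (intro sum_mono leA)
  hence "a \<beta> * b 1 \<le> \<kappa> * a 1 * b 1" using nonneg by (intro mult_right_mono)
  also have "\<kappa> * b 1 \<le> b \<beta>" unfolding b_def sum_distrib_left by (intro sum_mono geB)
  hence "a 1 * (\<kappa> * b 1) \<le> a 1 * b \<beta>" using nonneg by (intro mult_left_mono)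
  hence "\<kappa> * a 1 * b 1 \<le> a 1 * b \<beta>" by (simp add: mult_ac)
  finally have "a \<beta> / (a \<beta> + b \<beta>) \<le> a 1 / (a 1 + b 1)"
    using Zpos[of \<beta>] Zpos[of 1] by (simp add: divide_simps algebra_simps)
  thus ?thesis
    unfolding prob_curie_weiss Z a_def A_def w_def by simp
qed

lemma concentrates_at_below_one:
  assumes "\<beta> \<le> 1"
  shows "concentrates_at \<beta> 0"
  unfolding concentrates_at_def
proof (intro allI impI)
  fix \<epsilon> :: real assume \<epsilon>: "\<epsilon> > 0"
  let ?E = "\<lambda>n. {\<sigma>. \<epsilon> < \<bar>\<bar>magnetization n \<sigma>\<bar> - 0\<bar>}"
  have lim: "(\<lambda>n. measure_pmf.prob (curie_weiss n (1 / real n)) (?E n)) \<longlonglongrightarrow> 0"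
    using concentrates_at_one \<epsilon> unfolding concentrates_at_def by blast
  show "(\<lambda>n. measure_pmf.prob (curie_weiss n (\<beta> / real n)) (?E n)) \<longlonglongrightarrow> 0"
  proof (rule tendsto_sandwich[OF _ _ tendsto_const lim])
    show "\<forall>\<^sub>F n in sequentially. measure_pmf.prob (curie_weiss n (\<beta> / real n)) (?E n) \<le>
        measure_pmf.prob (curie_weiss n (1 / real n)) (?E n)"
      using eventually_gt_at_top[of 0]
      by eventually_elim (use prob_magnetization_le_critical[OF assms _ \<epsilon>] in simp)
  qed auto
qed

lemma concentrates_at_unique:
  assumes "concentrates_at \<beta> c" "concentrates_at \<beta> d"
  shows "c = d"
proof (rule ccontr)
  assume "c \<noteq> d"
  define \<epsilon> where "\<epsilon> = \<bar>c - d\<bar> / 3"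
  have \<epsilon>: "\<epsilon> > 0" using \<open>c \<noteq> d\<close> by (simp add: \<epsilon>_def)
  define P where "P = (\<lambda>n x. measure_pmf.prob (curie_weiss n (\<beta> / real n))
    {\<sigma>. \<epsilon> < \<bar>\<bar>magnetization n \<sigma>\<bar> - x\<bar>})"
  have "(\<lambda>n. P n c + P n d) \<longlonglongrightarrow> 0 + 0"
    using assms \<epsilon> unfolding P_def concentrates_at_def by (intro tendsto_add) auto
  moreover have "1 \<le> P n c + P n d" for n
  proof -
    have "UNIV = {\<sigma>. \<epsilon> < \<bar>\<bar>magnetization n \<sigma>\<bar> - c\<bar>} \<union> {\<sigma>. \<epsilon> < \<bar>\<bar>magnetization n \<sigma>\<bar> - d\<bar>}"
    proof -
      have "\<epsilon> < \<bar>x - c\<bar> \<or> \<epsilon> < \<bar>x - d\<bar>" for x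
      proof -
        have "3 * \<epsilon> \<le> \<bar>x - c\<bar> + \<bar>x - d\<bar>" unfolding \<epsilon>_def by simp
        thus ?thesis using \<epsilon> by linarith
      qed
      thus ?thesis by blast
    qed
    hence "1 = measure_pmf.prob (curie_weiss n (\<beta> / real n))
        ({\<sigma>. \<epsilon> < \<bar>\<bar>magnetization n \<sigma>\<bar> - c\<bar>} \<union> {\<sigma>. \<epsilon> < \<bar>\<bar>magnetization n \<sigma>\<bar> - d\<bar>})"
      by (metis measure_pmf_UNIV)
    also have "\<dots> \<le> P n c + P n d"
      unfolding P_def by (rule measure_Un_le) auto
    finally show ?thesis .
  qed
  ultimately have "1 \<le> (0 :: real)"
    by (intro LIMSEQ_le_const[where X = "\<lambda>n. P n c + P n d"]) auto
  thus False by simp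
qed

lemma critical_beta_eq_1: "critical_beta = 1"
  unfolding critical_beta_def
proof (rule the_equality)
  have "\<exists>c. concentrates_at \<beta> c \<and> (\<beta> \<le> 1 \<longrightarrow> c = 0) \<and> (\<beta> > 1 \<longrightarrow> 0 < c \<and> c < 1)" for \<beta>
    using concentrates_at_above_one[of \<beta>] concentrates_at_below_one[of \<beta>] by (cases "\<beta> \<le> 1") auto
  thus "0 < (1 :: real) \<and> (\<exists>c. \<forall>\<beta>. concentrates_at \<beta> (c \<beta>) \<and>
      (\<beta> \<le> 1 \<longrightarrow> c \<beta> = 0) \<and> (\<beta> > 1 \<longrightarrow> 0 < c \<beta> \<and> c \<beta> < 1))"
    by (intro conjI choice) auto
next
  fix b :: real
  assume b: "0 < b \<and> (\<exists>c :: real \<Rightarrow> real. \<forall>\<beta>. concentrates_at \<beta> (c \<beta>) \<and>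
    (\<beta> \<le> b \<longrightarrow> c \<beta> = 0) \<and> (\<beta> > b \<longrightarrow> 0 < c \<beta> \<and> c \<beta> < 1))"
  then obtain c :: "real \<Rightarrow> real" where c: "\<And>\<beta>. concentrates_at \<beta> (c \<beta>)"
    "\<And>\<beta>. \<beta> \<le> b \<Longrightarrow> c \<beta> = 0" "\<And>\<beta>. \<beta> > b \<Longrightarrow> 0 < c \<beta>" by blast
  have "\<not> b > 1"
  proof
    assume "b > 1"
    then obtain d where "0 < d" "concentrates_at b d" using concentrates_at_above_one by blast
    thus False using concentrates_at_unique[OF _ c(1)[of b]] c(2)[of b] by auto
  qed
  moreover have "\<not> b < 1"
    using concentrates_at_unique[OF concentrates_at_one c(1)[of 1]] c(3)[of 1] by auto
  ultimately show "b = 1" by simp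
qed

section \<open>The limiting finite-dimensional distributions\<close>

lemma exists_permutes_image:
  assumes "finite A" "K \<subseteq> A" "L \<subseteq> A" "card K = card L"
  shows "\<exists>\<pi>. \<pi> permutes A \<and> \<pi> ` K = L"
proof -
  have fin: "finite K" "finite L" using assms finite_subset by auto
  obtain f where f: "bij_betw f K L"
    using finite_same_card_bij[OF fin assms(4)] by blast
  have "card (A - K) = card (A - L)" using assms fin by (simp add: card_Diff_subset)
  then obtain g where g: "bij_betw g (A - K) (A - L)"
    using finite_same_card_bij[of "A - K" "A - L"] assms(1) by auto
  define \<pi> where "\<pi> = (\<lambda>x. if x \<in> K then f x else if x \<in> A then g x else x)"
  have 1: "bij_betw \<pi> K L"
    using f by (rule bij_betw_cong[THEN iffD1, rotated]) (simp add: \<pi>_def)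
  moreover have "bij_betw \<pi> (A - K) (A - L)"
    using g by (rule bij_betw_cong[THEN iffD1, rotated]) (simp add: \<pi>_def)
  ultimately have "bij_betw \<pi> (K \<union> (A - K)) (L \<union> (A - L))"
    by (rule bij_betw_combine) auto
  hence "bij_betw \<pi> A A" using assms by (simp add: Un_absorb1)
  hence "\<pi> permutes A" by (rule bij_imp_permutes) (use assms(2) in \<open>auto simp: \<pi>_def\<close>)
  thus ?thesis using 1 by (auto simp: bij_betw_def)
qed

lemma expectation_curie_weiss_permute:
  fixes f :: "(nat \<Rightarrow> real) \<Rightarrow> real"
  assumes \<pi>: "\<pi> permutes {1..n}"
  shows "measure_pmf.expectation (curie_weiss n J) (\<lambda>\<sigma>. f (\<sigma> \<circ> \<pi>)) =
    measure_pmf.expectation (curie_weiss n J) f"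
proof -
  have mem: "\<sigma> \<circ> \<rho> \<in> spin_configs n" if "\<rho> permutes {1..n}" "\<sigma> \<in> spin_configs n" for \<sigma> \<rho>
    using that permutes_in_image[OF that(1)] permutes_not_in[OF that(1)]
    by (auto simp: spin_configs_def PiE_iff extensional_def)
  have weight: "cw_weight n J (\<sigma> \<circ> \<pi>) = cw_weight n J \<sigma>" for \<sigma>
    unfolding cw_weight_def sum_pairs_eq
    using sum.permute[OF \<pi>, of \<sigma>] sum.permute[OF \<pi>, of "\<lambda>i. (\<sigma> i)\<^sup>2"] by (simp add: o_def)
  show ?thesis
    unfolding expectation_curie_weiss
    by (rule sum.reindex_bij_witness[where i = "\<lambda>\<sigma>. \<sigma> \<circ> inv \<pi>" and j = "\<lambda>\<sigma>. \<sigma> \<circ> \<pi>"])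
       (use \<pi> in \<open>auto simp: mem weight permutes_inv permutes_inv_o o_assoc[symmetric]\<close>)
qed

lemma expectation_curie_weiss_flip:
  fixes f :: "real \<Rightarrow> real"
  shows "measure_pmf.expectation (curie_weiss n J) (\<lambda>\<sigma>. f (- magnetization n \<sigma>)) =
    measure_pmf.expectation (curie_weiss n J) (\<lambda>\<sigma>. f (magnetization n \<sigma>))"
proof -
  define flip :: "(nat \<Rightarrow> real) \<Rightarrow> nat \<Rightarrow> real" where "flip = (\<lambda>\<sigma>. \<lambda>i\<in>{1..n}. - \<sigma> i)"
  have mem: "flip \<sigma> \<in> spin_configs n" if "\<sigma> \<in> spin_configs n" for \<sigma>
    using that by (auto simp: spin_configs_def flip_def PiE_iff)
  have flip_flip: "flip (flip \<sigma>) = \<sigma>" if "\<sigma> \<in> spin_configs n" for \<sigma>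
    using that by (auto simp: spin_configs_def flip_def PiE_iff extensional_def fun_eq_iff)
  have weight: "cw_weight n J (flip \<sigma>) = cw_weight n J \<sigma>" for \<sigma>
    unfolding cw_weight_def by (rule arg_cong[where f = "\<lambda>x. exp (J * x)"], rule sum.cong)
      (auto simp: flip_def)
  have mag: "magnetization n (flip \<sigma>) = - magnetization n \<sigma>" for \<sigma>
    by (simp add: magnetization_def flip_def sum_negf)
  show ?thesis
    unfolding expectation_curie_weiss
    by (rule sum.reindex_bij_witness[where i = flip and j = flip]) (simp_all add: mem flip_flip weight mag)
qed

text \<open>By exchangeability, trading one factor of the product over \<open>K\<close> for one power of the mean
  changes this expectation only by \<open>O(1/n)\<close>.\<close>

definition minus_moment :: "nat \<Rightarrow> real \<Rightarrow> nat set \<Rightarrow> nat \<Rightarrow> real" where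
  "minus_moment n J K l = measure_pmf.expectation (curie_weiss n J)
     (\<lambda>\<sigma>. (\<Prod>i\<in>K. (1 - \<sigma> i) / 2) * ((1 - magnetization n \<sigma>) / 2) ^ l)"

lemma minus_moment_card_eq:
  assumes "K \<subseteq> {1..n}" "L \<subseteq> {1..n}" "card K = card L"
  shows "minus_moment n J K l = minus_moment n J L l"
proof -
  obtain \<pi> where \<pi>: "\<pi> permutes {1..n}" "\<pi> ` K = L"
    using exists_permutes_image[of "{1..n}" K L] assms by auto
  have "magnetization n (\<sigma> \<circ> \<pi>) = magnetization n \<sigma>" for \<sigma>
    unfolding magnetization_def using sum.permute[OF \<pi>(1), of \<sigma>] by (simp add: o_def)
  moreover have "(\<Prod>i\<in>L. (1 - \<sigma> i) / 2) = (\<Prod>i\<in>K. (1 - (\<sigma> \<circ> \<pi>) i) / 2)" for \<sigma> :: "nat \<Rightarrow> real"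
    unfolding \<pi>(2)[symmetric]
    by (subst prod.reindex) (auto intro: inj_on_subset[OF permutes_inj[OF \<pi>(1)]])
  ultimately show ?thesis
    unfolding minus_moment_def
    using expectation_curie_weiss_permute[OF \<pi>(1), of J
      "\<lambda>\<sigma>. (\<Prod>i\<in>K. (1 - \<sigma> i) / 2) * ((1 - magnetization n \<sigma>) / 2) ^ l"] by simp
qed

lemma expectation_curie_weiss_bounds:
  fixes f :: "(nat \<Rightarrow> real) \<Rightarrow> real"
  assumes "\<And>\<sigma>. \<sigma> \<in> spin_configs n \<Longrightarrow> a \<le> f \<sigma> \<and> f \<sigma> \<le> b"
  shows "a \<le> measure_pmf.expectation (curie_weiss n J) f"
    "measure_pmf.expectation (curie_weiss n J) f \<le> b"
proof -
  have "AE \<sigma> in measure_pmf (curie_weiss n J). a \<le> f \<sigma> \<and> f \<sigma> \<le> b"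
    using assms by (auto simp: AE_measure_pmf_iff set_pmf_curie_weiss)
  thus "a \<le> measure_pmf.expectation (curie_weiss n J) f"
    "measure_pmf.expectation (curie_weiss n J) f \<le> b"
    by (auto intro!: measure_pmf.integral_ge_const measure_pmf.integral_le_const)
qed

lemma spin_minus_indicator:
  assumes "\<sigma> \<in> spin_configs n" "i \<in> {1..n}"
  shows "(1 - \<sigma> i) / 2 = (if \<sigma> i = -1 then 1 else 0)"
  using spin_configs_square[OF assms] by (auto simp: power2_eq_1_iff)

lemma minus_moment_bounds:
  assumes "K \<subseteq> {1..n}"
  shows "0 \<le> minus_moment n J K l" "minus_moment n J K l \<le> 1"
proof -
  have "0 \<le> (\<Prod>i\<in>K. (1 - \<sigma> i) / 2) * ((1 - magnetization n \<sigma>) / 2) ^ l \<and>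
      (\<Prod>i\<in>K. (1 - \<sigma> i) / 2) * ((1 - magnetization n \<sigma>) / 2) ^ l \<le> 1"
    if \<sigma>: "\<sigma> \<in> spin_configs n" for \<sigma>
  proof -
    have "0 \<le> (1 - \<sigma> i) / 2 \<and> (1 - \<sigma> i) / 2 \<le> 1" if "i \<in> K" for i
    proof -
      have "i \<in> {1..n}" using that assms by auto
      thus ?thesis unfolding spin_minus_indicator[OF \<sigma> \<open>i \<in> {1..n}\<close>] by simp
    qed
    hence "0 \<le> (\<Prod>i\<in>K. (1 - \<sigma> i) / 2)" "(\<Prod>i\<in>K. (1 - \<sigma> i) / 2) \<le> 1"
      by (auto intro!: prod_nonneg prod_le_1)
    moreover have "0 \<le> (1 - magnetization n \<sigma>) / 2" "(1 - magnetization n \<sigma>) / 2 \<le> 1"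
      using magnetization_bounds[OF \<sigma>] by auto
    ultimately show ?thesis by (auto intro!: mult_le_one power_le_one)
  qed
  from expectation_curie_weiss_bounds[OF this, where J = J]
  show "0 \<le> minus_moment n J K l" "minus_moment n J K l \<le> 1"
    unfolding minus_moment_def by auto
qed

lemma minus_moment_Suc:
  assumes "k < n"
  shows "real n * minus_moment n J {1..k} (Suc l) =
    real k * minus_moment n J {1..k} l + real (n - k) * minus_moment n J {1..Suc k} l"
proof -
  define y :: "(nat \<Rightarrow> real) \<Rightarrow> real" where "y = (\<lambda>\<sigma>. ((1 - magnetization n \<sigma>) / 2) ^ l)"
  define x :: "nat \<Rightarrow> (nat \<Rightarrow> real) \<Rightarrow> real" where "x = (\<lambda>i \<sigma>. (1 - \<sigma> i) / 2)"
  let ?E = "measure_pmf.expectation (curie_weiss n J)"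
  have mag: "real n * ((1 - magnetization n \<sigma>) / 2) = (\<Sum>i=1..n. x i \<sigma>)" for \<sigma>
  proof -
    have "(\<Sum>i=1..n. x i \<sigma>) = (real n - (\<Sum>i=1..n. \<sigma> i)) / 2"
      unfolding x_def sum_divide_distrib[symmetric] by (simp add: sum_subtractf)
    thus ?thesis unfolding sum_spins_eq_magnetization by (simp add: field_simps)
  qed
  have inside: "?E (\<lambda>\<sigma>. (\<Prod>j=1..k. x j \<sigma>) * x i \<sigma> * y \<sigma>) = minus_moment n J {1..k} l"
    if "i \<in> {1..k}" for i
    unfolding minus_moment_def
  proof (rule integral_cong_AE)
    have "(\<Prod>j=1..k. x j \<sigma>) * x i \<sigma> = (\<Prod>j=1..k. x j \<sigma>)" if "\<sigma> \<in> spin_configs n" for \<sigma>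
    proof -
      have "x i \<sigma> * x i \<sigma> = x i \<sigma>"
        using spin_minus_indicator[OF that, of i] \<open>i \<in> {1..k}\<close> assms by (simp add: x_def)
      moreover have "(\<Prod>j=1..k. x j \<sigma>) = x i \<sigma> * (\<Prod>j\<in>{1..k} - {i}. x j \<sigma>)"
        using \<open>i \<in> {1..k}\<close> by (intro prod.remove) auto
      ultimately show ?thesis by (metis mult.assoc mult.commute)
    qed
    thus "AE \<sigma> in measure_pmf (curie_weiss n J). (\<Prod>j=1..k. x j \<sigma>) * x i \<sigma> * y \<sigma> =
        (\<Prod>j\<in>{1..k}. (1 - \<sigma> j) / 2) * ((1 - magnetization n \<sigma>) / 2) ^ l"
      by (auto simp: AE_measure_pmf_iff set_pmf_curie_weiss x_def y_def)
  qed auto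
  have outside: "?E (\<lambda>\<sigma>. (\<Prod>j=1..k. x j \<sigma>) * x i \<sigma> * y \<sigma>) = minus_moment n J {1..Suc k} l"
    if "i \<in> {Suc k..n}" for i
  proof -
    have "(\<Prod>j=1..k. x j \<sigma>) * x i \<sigma> = (\<Prod>j\<in>insert i {1..k}. x j \<sigma>)" for \<sigma>
      using that by (subst prod.insert) (auto simp: mult_ac)
    hence "?E (\<lambda>\<sigma>. (\<Prod>j=1..k. x j \<sigma>) * x i \<sigma> * y \<sigma>) = minus_moment n J (insert i {1..k}) l"
      by (simp add: minus_moment_def x_def y_def)
    also have "\<dots> = minus_moment n J {1..Suc k} l"
      using that by (intro minus_moment_card_eq) auto
    finally show ?thesis .
  qed
  have "real n * minus_moment n J {1..k} (Suc l) =
      ?E (\<lambda>\<sigma>. real n * ((\<Prod>j=1..k. x j \<sigma>) * (((1 - magnetization n \<sigma>) / 2) * y \<sigma>)))"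
    by (simp add: minus_moment_def x_def y_def)
  also have "(\<lambda>\<sigma>. real n * ((\<Prod>j=1..k. x j \<sigma>) * (((1 - magnetization n \<sigma>) / 2) * y \<sigma>))) =
      (\<lambda>\<sigma>. \<Sum>i=1..n. (\<Prod>j=1..k. x j \<sigma>) * x i \<sigma> * y \<sigma>)"
  proof
    fix \<sigma>
    have "real n * ((\<Prod>j=1..k. x j \<sigma>) * (((1 - magnetization n \<sigma>) / 2) * y \<sigma>)) =
        (\<Prod>j=1..k. x j \<sigma>) * (real n * ((1 - magnetization n \<sigma>) / 2)) * y \<sigma>"
      by (simp only: mult_ac)
    thus "real n * ((\<Prod>j=1..k. x j \<sigma>) * (((1 - magnetization n \<sigma>) / 2) * y \<sigma>)) =
        (\<Sum>i=1..n. (\<Prod>j=1..k. x j \<sigma>) * x i \<sigma> * y \<sigma>)"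
      unfolding mag by (simp only: sum_distrib_left sum_distrib_right)
  qed
  also have "?E \<dots> = (\<Sum>i=1..n. ?E (\<lambda>\<sigma>. (\<Prod>j=1..k. x j \<sigma>) * x i \<sigma> * y \<sigma>))"
    by (rule Bochner_Integration.integral_sum) auto
  also have "{1..n} = {1..k} \<union> {Suc k..n}" using assms by auto
  also have "(\<Sum>i\<in>{1..k} \<union> {Suc k..n}. ?E (\<lambda>\<sigma>. (\<Prod>j=1..k. x j \<sigma>) * x i \<sigma> * y \<sigma>)) =
      (\<Sum>i\<in>{1..k}. minus_moment n J {1..k} l) + (\<Sum>i\<in>{Suc k..n}. minus_moment n J {1..Suc k} l)"
    by (subst sum.union_disjoint) (auto simp del: One_nat_def simp: inside outside)
  finally show ?thesis by simp
qed

lemma minus_moment_approx: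
  assumes "k \<le> n"
  shows "\<bar>minus_moment n J {1..k} l - minus_moment n J {} (k + l)\<bar> \<le> real k * real k / real n"
  using assms
proof (induction k arbitrary: l)
  case (Suc k)
  define a where "a = minus_moment n J {1..k} l"
  define b where "b = minus_moment n J {1..Suc k} l"
  define c where "c = minus_moment n J {1..k} (Suc l)"
  have n: "n > 0" using Suc.prems by simp
  have "real n * c = real k * a + (real n - real k) * b"
    using minus_moment_Suc[of k n J l] Suc.prems by (simp add: a_def b_def c_def of_nat_diff)
  hence "real n * (b - c) = real k * (b - a)" by (simp add: algebra_simps)
  hence "b - c = real k * (b - a) / real n" using n by (simp add: field_simps)
  moreover have "\<bar>b - a\<bar> \<le> 1"
    using minus_moment_bounds[of "{1..k}" n J l] minus_moment_bounds[of "{1..Suc k}" n J l] Suc.prems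
    by (auto simp: a_def b_def abs_le_iff)
  ultimately have "\<bar>b - c\<bar> \<le> real k * 1 / real n"
    by (simp add: abs_mult divide_right_mono mult_left_le)
  moreover have "\<bar>c - minus_moment n J {} (Suc k + l)\<bar> \<le> real k * real k / real n"
    using Suc.IH[of "Suc l"] Suc.prems by (simp add: c_def)
  ultimately have "\<bar>b - minus_moment n J {} (Suc k + l)\<bar> \<le> real k * 1 / real n + real k * real k / real n"
    by linarith
  also have "\<dots> \<le> real (Suc k) * real (Suc k) / real n"
    unfolding add_divide_distrib[symmetric] by (intro divide_right_mono) (auto simp: algebra_simps)
  finally show ?case by (simp add: b_def)
qed simp

lemma concentrates_at_expectation:
  fixes h :: "real \<Rightarrow> real"
  assumes conc: "concentrates_at \<beta> c" and cont: "isCont h c"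
    and bound: "\<And>u. 0 \<le> u \<Longrightarrow> u \<le> 1 \<Longrightarrow> \<bar>h u - h c\<bar> \<le> M"
  shows "(\<lambda>n. measure_pmf.expectation (curie_weiss n (\<beta> / real n)) (\<lambda>\<sigma>. h \<bar>magnetization n \<sigma>\<bar>))
    \<longlonglongrightarrow> h c"
proof (rule LIMSEQ_I)
  fix e :: real assume e: "e > 0"
  obtain d where d: "d > 0" "\<And>u. \<bar>u - c\<bar> < d \<Longrightarrow> \<bar>h u - h c\<bar> < e / 2"
    using cont[unfolded continuous_at_eps_delta] e by (metis dist_real_def half_gt_zero)
  define P where "P = (\<lambda>n. measure_pmf.prob (curie_weiss n (\<beta> / real n))
    {\<sigma>. \<bar>\<bar>magnetization n \<sigma>\<bar> - c\<bar> > d / 2})"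
  have "P \<longlonglongrightarrow> 0"
    unfolding P_def by (rule conc[unfolded concentrates_at_def, rule_format]) (use d(1) in simp)
  hence "(\<lambda>n. M * P n) \<longlonglongrightarrow> M * 0" by (intro tendsto_mult tendsto_const)
  hence "eventually (\<lambda>n. M * P n < e / 2) sequentially"
    using e by (intro order_tendstoD(2)) auto
  then obtain n0 where n0: "\<And>n. n \<ge> n0 \<Longrightarrow> M * P n < e / 2" by (auto simp: eventually_sequentially)
  show "\<exists>n0. \<forall>n\<ge>n0. norm (measure_pmf.expectation (curie_weiss n (\<beta> / real n))
    (\<lambda>\<sigma>. h \<bar>magnetization n \<sigma>\<bar>) - h c) < e"
  proof (intro exI allI impI)
    fix n assume "n \<ge> n0"
    let ?E = "measure_pmf.expectation (curie_weiss n (\<beta> / real n))"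
    let ?A = "{\<sigma>. \<bar>\<bar>magnetization n \<sigma>\<bar> - c\<bar> > d / 2}"
    have "\<bar>?E (\<lambda>\<sigma>. h \<bar>magnetization n \<sigma>\<bar>) - h c\<bar> = \<bar>?E (\<lambda>\<sigma>. h \<bar>magnetization n \<sigma>\<bar> - h c)\<bar>"
      by simp
    also have "\<dots> \<le> ?E (\<lambda>\<sigma>. \<bar>h \<bar>magnetization n \<sigma>\<bar> - h c\<bar>)" by (rule integral_abs_bound)
    also have "\<dots> \<le> ?E (\<lambda>\<sigma>. e / 2 + M * indicator ?A \<sigma>)"
    proof (rule integral_mono_AE)
      have "\<bar>h \<bar>magnetization n \<sigma>\<bar> - h c\<bar> \<le> e / 2 + M * indicator ?A \<sigma>"
        if "\<sigma> \<in> spin_configs n" for \<sigma>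
        using bound[of "\<bar>magnetization n \<sigma>\<bar>"] magnetization_bounds[OF that]
          d(2)[of "\<bar>magnetization n \<sigma>\<bar>"] d(1) e
        by (cases "\<sigma> \<in> ?A") auto
      thus "AE \<sigma> in measure_pmf (curie_weiss n (\<beta> / real n)).
          \<bar>h \<bar>magnetization n \<sigma>\<bar> - h c\<bar> \<le> e / 2 + M * indicator ?A \<sigma>"
        by (auto simp: AE_measure_pmf_iff set_pmf_curie_weiss)
    qed auto
    also have "\<dots> = e / 2 + M * P n" by (simp add: P_def)
    finally show "norm (?E (\<lambda>\<sigma>. h \<bar>magnetization n \<sigma>\<bar>) - h c) < e"
      using n0[OF \<open>n \<ge> n0\<close>] by simp
  qed
qed

lemma minus_moment_limit:
  assumes conc: "concentrates_at \<beta> c" and c: "0 \<le> c" "c \<le> 1"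
  shows "(\<lambda>n. minus_moment n (\<beta> / real n) {1..k} 0) \<longlonglongrightarrow> (((1 - c) / 2) ^ k + ((1 + c) / 2) ^ k) / 2"
proof -
  define h :: "real \<Rightarrow> real" where "h = (\<lambda>u. (((1 - u) / 2) ^ k + ((1 + u) / 2) ^ k) / 2)"
  have h_abs: "h \<bar>u\<bar> = h u" for u by (cases "u \<ge> 0") (auto simp: h_def)
  have h_bounds: "0 \<le> h u \<and> h u \<le> 1" if "0 \<le> u" "u \<le> 1" for u
  proof -
    have "((1 - u) / 2) ^ k \<le> 1" "((1 + u) / 2) ^ k \<le> 1" using that by (auto intro!: power_le_one)
    thus ?thesis using that by (auto simp: h_def)
  qed
  have moment: "minus_moment n J {} k =
      measure_pmf.expectation (curie_weiss n J) (\<lambda>\<sigma>. h \<bar>magnetization n \<sigma>\<bar>)" for n J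
    unfolding h_abs unfolding minus_moment_def h_def
    using expectation_curie_weiss_flip[of n J "\<lambda>m. ((1 - m) / 2) ^ k"] by simp
  have "(\<lambda>n. minus_moment n (\<beta> / real n) {} k) \<longlonglongrightarrow> h c"
    unfolding moment
  proof (rule concentrates_at_expectation[OF conc])
    show "isCont h c" unfolding h_def by (intro continuous_intros) auto
    show "\<bar>h u - h c\<bar> \<le> 1" if "0 \<le> u" "u \<le> 1" for u
      using h_bounds[OF that] h_bounds[OF c] by (auto simp: abs_le_iff)
  qed
  moreover have "(\<lambda>n. minus_moment n (\<beta> / real n) {1..k} 0 - minus_moment n (\<beta> / real n) {} k) \<longlonglongrightarrow> 0"
  proof (rule Lim_null_comparison)
    show "\<forall>\<^sub>F n in sequentially. norm (minus_moment n (\<beta> / real n) {1..k} 0 -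
        minus_moment n (\<beta> / real n) {} k) \<le> real k * real k / real n"
      using eventually_ge_at_top[of k] by eventually_elim (use minus_moment_approx[of k _ _ 0] in simp)
    show "(\<lambda>n. real k * real k / real n) \<longlonglongrightarrow> 0" by (rule lim_const_over_n)
  qed
  ultimately have "(\<lambda>n. minus_moment n (\<beta> / real n) {1..k} 0 - minus_moment n (\<beta> / real n) {} k +
      minus_moment n (\<beta> / real n) {} k) \<longlonglongrightarrow> 0 + h c" by (intro tendsto_add)
  thus ?thesis by (simp add: h_def)
qed

lemma prob_curie_weiss_01_zero:
  assumes "K \<subseteq> {1..n}"
  shows "measure_pmf.prob (curie_weiss_01 n J) {f. \<forall>i\<in>K. f i = 0} = minus_moment n J {1..card K} 0"
proof -
  have fin: "finite K" using assms finite_subset by blast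
  have "measure_pmf.prob (curie_weiss_01 n J) {f. \<forall>i\<in>K. f i = 0} =
      measure_pmf.expectation (curie_weiss n J) (indicator {\<sigma>. \<forall>i\<in>K. \<sigma> i = -1})"
  proof -
    have "(\<lambda>\<sigma>. \<lambda>i\<in>{1..n}. if \<sigma> i = - 1 then 0 else 1) -` {f :: nat \<Rightarrow> nat. \<forall>i\<in>K. f i = 0} =
        {\<sigma> :: nat \<Rightarrow> real. \<forall>i\<in>K. \<sigma> i = - 1}"
      using assms by (auto split: if_splits simp: subset_iff)
    thus ?thesis unfolding curie_weiss_01_def by simp
  qed
  also have "\<dots> = minus_moment n J K 0"
    unfolding minus_moment_def
  proof (rule integral_cong_AE)
    have "indicator {\<sigma>. \<forall>i\<in>K. \<sigma> i = -1} \<sigma> = (\<Prod>i\<in>K. (1 - \<sigma> i) / 2)"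
      if "\<sigma> \<in> spin_configs n" for \<sigma>
    proof -
      have "(\<Prod>i\<in>K. (1 - \<sigma> i) / 2) = (\<Prod>i\<in>K. if \<sigma> i = -1 then 1 else 0)"
        using assms by (intro prod.cong refl spin_minus_indicator[OF that]) auto
      also have "\<dots> = indicator {\<sigma>. \<forall>i\<in>K. \<sigma> i = -1} \<sigma>"
        using fin by (auto simp: indicator_def intro!: prod.neutral)
      finally show ?thesis by simp
    qed
    thus "AE \<sigma> in measure_pmf (curie_weiss n J). indicator {\<sigma>. \<forall>i\<in>K. \<sigma> i = -1} \<sigma> =
        (\<Prod>i\<in>K. (1 - \<sigma> i) / 2) * ((1 - magnetization n \<sigma>) / 2) ^ 0"
      by (auto simp: AE_measure_pmf_iff set_pmf_curie_weiss)
  qed auto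
  also have "\<dots> = minus_moment n J {1..card K} 0"
    using assms card_mono[OF _ assms] by (intro minus_moment_card_eq) auto
  finally show ?thesis .
qed

section \<open>Iterated differences\<close>

primrec iterated_diff :: "nat \<Rightarrow> (nat \<Rightarrow> real) \<Rightarrow> nat \<Rightarrow> real" where
  "iterated_diff 0 f k = f k"
| "iterated_diff (Suc l) f k = iterated_diff l f k - iterated_diff l f (Suc k)"

lemma iterated_diff_power: "iterated_diff l (\<lambda>k. s ^ k) k = s ^ k * (1 - s) ^ l"
  by (induction l arbitrary: k) (auto simp: algebra_simps)

lemma iterated_diff_cmult: "iterated_diff l (\<lambda>k. a * f k) k = a * iterated_diff l f k"
  by (induction l arbitrary: k) (auto simp: algebra_simps)

lemma iterated_diff_add:
  "iterated_diff l (\<lambda>k. f k + g k) k = iterated_diff l f k + iterated_diff l g k"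
  by (induction l arbitrary: k) auto

lemma iterated_diff_const: "iterated_diff l (\<lambda>_. a) k = (if l = 0 then a else 0)"
  by (induction l arbitrary: k) auto

lemma iterated_diff_linear: "l \<ge> 2 \<Longrightarrow> iterated_diff l (\<lambda>k. real k * a) k = 0"
proof (induction l arbitrary: k rule: dec_induct)
  case base
  show ?case by (simp add: numeral_2_eq_2 algebra_simps)
qed auto

lemma tendsto_iterated_diff:
  assumes "\<And>k. ((\<lambda>n. f n k) \<longlongrightarrow> g k) F"
  shows "((\<lambda>n. iterated_diff l (f n) k) \<longlongrightarrow> iterated_diff l g k) F"
  using assms by (induction l arbitrary: k) (auto intro: tendsto_diff)

lemma sums_iterated_diff:
  assumes "\<And>k. k > 0 \<Longrightarrow> (\<lambda>n. f n k) sums g k" "k > 0"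
  shows "(\<lambda>n. iterated_diff l (f n) k) sums iterated_diff l g k"
  using assms(2) by (induction l arbitrary: k) (auto intro: sums_diff assms(1))

lemma (in sigma_finite_measure) finite_measure_finite_space:
  assumes "finite (space M)" "sets M = Pow (space M)"
  shows "finite_measure M"
proof (rule finite_measureI)
  obtain F :: "nat \<Rightarrow> _" where F: "range F \<subseteq> sets M" "(\<Union>i. F i) = space M"
    "\<And>i. emeasure M (F i) \<noteq> \<infinity>"
    by (rule sigma_finite) blast
  have "emeasure M {x} \<noteq> \<infinity>" if "x \<in> space M" for x
  proof -
    have "x \<in> (\<Union>i. F i)" unfolding F(2) by (rule that)
    then obtain i where "x \<in> F i" by blast
    hence "emeasure M {x} \<le> emeasure M (F i)" using F(1) by (intro emeasure_mono) auto
    thus ?thesis using F(3)[of i] by (auto simp: top_unique)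
  qed
  moreover have "emeasure M (space M) = (\<Sum>x\<in>space M. emeasure M {x})"
    using assms by (intro emeasure_eq_sum_singleton) auto
  ultimately show "emeasure M (space M) \<noteq> \<infinity>" using assms(1) by simp
qed

text \<open>The iterated difference is the intensity of the sets that contain \<open>L\<close> and avoid \<open>K\<close>.\<close>

lemma poisson_representable_iterated_diff_nonneg:
  fixes S :: "'a set"
  assumes S: "finite S" and p: "p \<in> poisson_representable S"
    and q: "\<And>K. K \<subseteq> S \<Longrightarrow> measure_pmf.prob p {f. \<forall>i\<in>K. f i = 0} = q (card K)"
    and KL: "K \<subseteq> S" "L \<subseteq> S" "K \<inter> L = {}" "L \<noteq> {}"
  shows "iterated_diff (card L) (\<lambda>k. ln (q k)) (card K) \<ge> 0"
proof -
  obtain \<nu> Q where \<nu>: "sigma_finite_measure \<nu>" "space \<nu> = Pow S - {{}}" "sets \<nu> = Pow (Pow S - {{}})"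
    and Q: "poisson_process (measure_pmf Q) \<nu> (\<lambda>y. y)" and p_eq: "p = map_pmf (covered S) Q"
    using p unfolding poisson_representable_def by blast
  have "finite (space \<nu>)" using S \<nu>(2) by simp
  then interpret finite_measure \<nu>
    using sigma_finite_measure.finite_measure_finite_space[OF \<nu>(1)] \<nu>(2,3) by simp
  define hit where "hit = (\<lambda>K. {B \<in> space \<nu>. B \<inter> K \<noteq> {}})"
  define mass where "mass = (\<lambda>K L. measure \<nu> {B \<in> space \<nu>. B \<inter> K = {} \<and> L \<subseteq> B})"
  have sets [simp]: "{B \<in> space \<nu>. P B} \<in> sets \<nu>" for P using \<nu> by auto
  have ln_q: "ln (q (card K)) = - measure \<nu> (hit K)" if "K \<subseteq> S" for K
  proof -
    have "q (card K) = measure_pmf.prob Q {y. \<forall>i\<in>K. covered S y i = 0}"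
      using q[OF that] by (simp add: p_eq vimage_def)
    also have "\<dots> = measure_pmf.prob Q {y. num_points (hit K) y = 0}"
    proof (rule measure_pmf.finite_measure_eq_AE)
      have "AE y in measure_pmf Q. set_mset y \<subseteq> space \<nu>"
        using Q by (simp add: poisson_process_def)
      thus "AE y in measure_pmf Q. (y \<in> {y. \<forall>i\<in>K. covered S y i = 0}) = (y \<in> {y. num_points (hit K) y = 0})"
      proof eventually_elim
        case (elim y)
        have "(\<forall>i\<in>K. covered S y i = 0) \<longleftrightarrow> (\<forall>i\<in>K. \<forall>B\<in>#y. i \<notin> B)"
          using that by (auto simp: covered_def subset_iff)
        also have "\<dots> \<longleftrightarrow> (\<forall>B\<in>#y. B \<notin> hit K)"
          using elim by (auto simp: hit_def)
        also have "\<dots> \<longleftrightarrow> num_points (hit K) y = 0"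
          by (auto simp: num_points_def)
        finally show ?case by simp
      qed
    qed auto
    also have "\<dots> = exp (- measure \<nu> (hit K))"
    proof -
      have "hit K \<in> sets \<nu>" by (simp add: hit_def)
      hence "measure_pmf.prob Q {y \<in> space (measure_pmf Q). num_points (hit K) y = 0} =
          measure \<nu> (hit K) ^ 0 / fact 0 * exp (- measure \<nu> (hit K))"
        using Q unfolding poisson_process_def by blast
      thus ?thesis by simp
    qed
    finally show ?thesis by simp
  qed
  have mass_empty: "mass K {} = measure \<nu> (space \<nu>) + ln (q (card K))" if "K \<subseteq> S" for K
  proof -
    have "{B \<in> space \<nu>. B \<inter> K = {} \<and> {} \<subseteq> B} = space \<nu> - hit K" by (auto simp: hit_def)
    thus ?thesis
      unfolding mass_def using ln_q[OF that] by (simp add: finite_measure_compl hit_def)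
  qed
  have mass_insert: "mass K (insert x L) = mass K L - mass (insert x K) L" for K L x
  proof -
    have "{B \<in> space \<nu>. B \<inter> K = {} \<and> insert x L \<subseteq> B} =
        {B \<in> space \<nu>. B \<inter> K = {} \<and> L \<subseteq> B} - {B \<in> space \<nu>. B \<inter> insert x K = {} \<and> L \<subseteq> B}"
      by auto
    thus ?thesis
      unfolding mass_def by (subst finite_measure_Diff[symmetric]) auto
  qed
  have "finite L" using KL(2) S by (rule finite_subset)
  hence "mass K L = iterated_diff (card L) (\<lambda>k. measure \<nu> (space \<nu>) + ln (q k)) (card K)"
    using KL(1-3)
  proof (induction L arbitrary: K rule: finite_induct)
    case empty
    thus ?case by (simp add: mass_empty)
  next
    case (insert x L)
    have "finite K" using insert.prems(1) S by (rule finite_subset)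
    have "x \<notin> K" using insert.prems by auto
    have "mass K L = iterated_diff (card L) (\<lambda>k. measure \<nu> (space \<nu>) + ln (q k)) (card K)"
      using insert.prems by (intro insert.IH) auto
    moreover have "mass (insert x K) L =
        iterated_diff (card L) (\<lambda>k. measure \<nu> (space \<nu>) + ln (q k)) (card (insert x K))"
      using insert.prems insert.hyps by (intro insert.IH) auto
    moreover have "card (insert x K) = Suc (card K)" "card (insert x L) = Suc (card L)"
      using \<open>finite K\<close> \<open>x \<notin> K\<close> insert.hyps by simp_all
    ultimately show ?case by (simp only: mass_insert iterated_diff.simps)
  qed
  also have "\<dots> = iterated_diff (card L) (\<lambda>k. ln (q k)) (card K)"
    using KL(4) \<open>finite L\<close> by (simp add: iterated_diff_add iterated_diff_const)
  finally show ?thesis by (metis mass_def measure_nonneg)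
qed

text \<open>
  Expanding the logarithm, the differences are integrals of \<open>s\<^sup>k (1 - s)\<^sup>l\<close> against the signed measure
  with mass \<open>(-1)\<^bsup>n+1\<^esup> / n\<close> at \<open>r\<^sup>n\<close>. Bernstein polynomials of a nonnegative bump around \<open>r\<^sup>2\<close>, where
  the mass is negative, isolate a pair \<open>k, l\<close> for which this integral is negative. The factor
  \<open>s (1 - s)\<^sup>2\<close> makes the series absolutely convergent and forces \<open>l \<ge> 2\<close>.
\<close>

lemma ln_one_plus_power_not_completely_monotone:
  fixes r :: real
  assumes r: "0 < r" "r < 1"
  shows "\<exists>k l. l \<ge> 2 \<and> iterated_diff l (\<lambda>k. ln (1 + r ^ k)) k < 0"
proof (rule ccontr)
  define H where "H = (\<lambda>k l. iterated_diff l (\<lambda>k. ln (1 + r ^ k)) k)"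
  assume "\<not> ?thesis"
  hence H_nonneg: "H k l \<ge> 0" if "l \<ge> 2" for k l using that unfolding H_def by (meson not_less)
  define w :: "nat \<Rightarrow> real" where "w = (\<lambda>n. - ((-1) ^ n) / real n)"
  have H_sums: "(\<lambda>n. w n * ((r ^ n) ^ k * (1 - r ^ n) ^ l)) sums H k l" if "k > 0" for k l
  proof -
    have "(\<lambda>n. w n * (r ^ n) ^ k) sums ln (1 + r ^ k)" if "k > 0" for k
    proof -
      have "\<bar>r ^ k\<bar> < 1" using r that by (simp add: power_Suc_less_one power_less_one_iff)
      from ln_series'[OF this] show ?thesis
        by (rule back_subst[where P = "\<lambda>f. f sums _"])
           (auto simp: w_def fun_eq_iff power_minus[of "r ^ k"] power_mult[symmetric] mult.commute)
    qed
    hence "(\<lambda>n. iterated_diff l (\<lambda>k. w n * (r ^ n) ^ k) k) sums iterated_diff l (\<lambda>k. ln (1 + r ^ k)) k"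
      by (rule sums_iterated_diff) (use that in auto)
    thus ?thesis
      unfolding H_def by (simp add: iterated_diff_cmult iterated_diff_power)
  qed

  define d where "d = r\<^sup>2 * (1 - r)"
  have d: "d > 0" using r by (simp add: d_def)
  define g where "g = (\<lambda>s. max 0 (1 - \<bar>s - r\<^sup>2\<bar> / d))"
  have g_nonneg: "g s \<ge> 0" for s by (simp add: g_def)
  have g2: "g (r ^ 2) = 1" by (simp add: g_def)
  have g_other: "g (r ^ n) = 0" if n: "n > 0" "n \<noteq> 2" for n
  proof -
    have "\<bar>r ^ n - r\<^sup>2\<bar> \<ge> d"
    proof (cases "n = 1")
      case True
      have "r * (r * (1 - r)) \<le> 1 * (r * (1 - r))" using r by (intro mult_right_mono) auto
      thus ?thesis using True by (simp add: d_def power2_eq_square algebra_simps)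
    next
      case False
      hence "r ^ n \<le> r ^ 3" using n r by (intro power_decreasing) auto
      thus ?thesis by (simp add: d_def power2_eq_square power3_eq_cube algebra_simps)
    qed
    thus ?thesis using d by (simp add: g_def)
  qed

  define X where "X = r\<^sup>2 * (1 - r\<^sup>2)\<^sup>2"
  have "r\<^sup>2 < 1" using r by (simp add: power_less_one_iff)
  hence X: "X > 0" using r by (simp add: X_def)
  define e where "e = (1 - r) * (X / 4)"
  have e: "e > 0" using r X by (simp add: e_def)
  have "continuous_on {0..1} g" unfolding g_def by (intro continuous_intros) (use d in auto)
  from Bernstein_Weierstrass[OF this e]
  obtain N where N: "\<And>x. x \<in> {0..1} \<Longrightarrow> \<bar>g x - (\<Sum>k\<le>N. g (real k / real N) * Bernstein N k x)\<bar> < e"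
    by blast
  define P where "P = (\<lambda>x. \<Sum>k\<le>N. g (real k / real N) * Bernstein N k x)"
  define a where "a = (\<lambda>n. w n * (r ^ n * (1 - r ^ n)\<^sup>2))"
  have "(\<lambda>n. \<Sum>k\<le>N. g (real k / real N) * real (N choose k) *
      (w n * ((r ^ n) ^ (k + 1) * (1 - r ^ n) ^ (N - k + 2)))) sums
      (\<Sum>k\<le>N. g (real k / real N) * real (N choose k) * H (k + 1) (N - k + 2))"
    by (intro sums_sum sums_mult H_sums) auto
  also have "(\<lambda>n. \<Sum>k\<le>N. g (real k / real N) * real (N choose k) *
      (w n * ((r ^ n) ^ (k + 1) * (1 - r ^ n) ^ (N - k + 2)))) = (\<lambda>n. a n * P (r ^ n))"
    unfolding a_def P_def Bernstein_def sum_distrib_left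
    by (intro ext sum.cong refl) (simp add: power_add mult_ac power2_eq_square)
  finally have aP: "(\<lambda>n. a n * P (r ^ n)) sums
      (\<Sum>k\<le>N. g (real k / real N) * real (N choose k) * H (k + 1) (N - k + 2))" .
  have ag: "(\<lambda>n. a n * g (r ^ n)) sums (a 2 * g (r ^ 2))"
  proof -
    have "(\<lambda>n. if n = 2 then a n * g (r ^ n) else 0) sums (a 2 * g (r ^ 2))" by (rule sums_single)
    moreover have "(\<lambda>n. if n = 2 then a n * g (r ^ n) else 0) = (\<lambda>n. a n * g (r ^ n))"
      by (auto simp: fun_eq_iff a_def w_def intro!: g_other)
    ultimately show ?thesis by simp
  qed
  have geom: "(\<lambda>n. e * r ^ n) sums (e * (1 / (1 - r)))"
    using r by (intro sums_mult geometric_sums) auto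
  have le: "a n * P (r ^ n) \<le> a n * g (r ^ n) + e * r ^ n" for n
  proof -
    have rn: "0 \<le> r ^ n" "r ^ n \<le> 1" using r by (auto simp: power_le_one)
    have "\<bar>w n\<bar> \<le> 1" by (cases "n = 0") (auto simp: w_def abs_mult divide_simps power_abs)
    moreover have "(1 - r ^ n)\<^sup>2 \<le> 1" using rn by (simp add: power_le_one)
    ultimately have "\<bar>w n\<bar> * (r ^ n * (1 - r ^ n)\<^sup>2) \<le> 1 * (r ^ n * 1)"
      using rn by (intro mult_mono) auto
    hence an: "\<bar>a n\<bar> \<le> r ^ n" using rn by (simp add: a_def abs_mult)
    have "a n * (P (r ^ n) - g (r ^ n)) \<le> \<bar>a n\<bar> * \<bar>P (r ^ n) - g (r ^ n)\<bar>"
      by (simp add: abs_mult[symmetric])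
    also have "\<dots> \<le> r ^ n * e"
      using N[of "r ^ n"] rn an by (intro mult_mono) (auto simp: P_def abs_minus_commute)
    finally show ?thesis by (simp add: algebra_simps)
  qed
  have "0 \<le> (\<Sum>k\<le>N. g (real k / real N) * real (N choose k) * H (k + 1) (N - k + 2))"
    by (intro sum_nonneg mult_nonneg_nonneg g_nonneg H_nonneg) auto
  also have "\<dots> \<le> a 2 * g (r ^ 2) + e * (1 / (1 - r))"
    by (rule sums_le[OF le aP sums_add[OF ag geom]])
  also have "\<dots> = - X / 4"
  proof -
    have "a 2 = - X / 2" by (simp add: a_def w_def X_def)
    moreover have "e / (1 - r) = X / 4"
      unfolding e_def by (rule nonzero_mult_div_cancel_left) (use r in simp)
    hence "e * (1 / (1 - r)) = X / 4" by simp
    ultimately show ?thesis unfolding g2 by linarith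
  qed
  finally show False using X by simp
qed

theorem theorem5p2:
  fixes \<beta> :: real
  assumes "\<beta> > critical_beta"
  shows "\<forall>\<^sub>F n in sequentially.
    curie_weiss_01 n (\<beta> / real n) \<notin> poisson_representable {1..n}"
proof -
  obtain c where c: "0 < c" "c < 1" "concentrates_at \<beta> c"
    using concentrates_at_above_one[of \<beta>] assms by (auto simp: critical_beta_eq_1)
  define p where "p = (1 + c) / 2"
  define r where "r = (1 - c) / (1 + c)"
  have p: "p > 0" and r: "0 < r" "r < 1"
    using c by (auto simp: p_def r_def)
  have pr: "p * r = (1 - c) / 2"
    unfolding p_def r_def using c by (simp add: divide_simps)
  obtain k l where l: "l \<ge> 2" and neg: "iterated_diff l (\<lambda>k. ln (1 + r ^ k)) k < 0"
    using ln_one_plus_power_not_completely_monotone[OF r] by blast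
  define q where "q = (\<lambda>n k. minus_moment n (\<beta> / real n) {1..k} 0)"
  have ln_q: "(\<lambda>n. ln (q n j)) \<longlonglongrightarrow> real j * ln p + (ln (1 + r ^ j) + - ln 2)" for j
  proof -
    have pos: "p ^ j > 0" "1 + r ^ j > 0" using p r by (auto intro: add_pos_pos)
    have "q n j = minus_moment n (\<beta> / real n) {1..j} 0" for n by (simp add: q_def)
    hence "(\<lambda>n. q n j) \<longlonglongrightarrow> ((p * r) ^ j + p ^ j) / 2"
      using minus_moment_limit[OF c(3), of j] c unfolding pr by (simp add: p_def)
    also have "((p * r) ^ j + p ^ j) / 2 = p ^ j * (1 + r ^ j) / 2"
      by (simp add: power_mult_distrib algebra_simps)
    finally have "(\<lambda>n. ln (q n j)) \<longlonglongrightarrow> ln (p ^ j * (1 + r ^ j) / 2)"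
      using pos p by (intro tendsto_ln) auto
    also have "ln (p ^ j * (1 + r ^ j) / 2) = real j * ln p + (ln (1 + r ^ j) + - ln 2)"
      using pos p by (simp add: ln_mult ln_div ln_realpow)
    finally show ?thesis .
  qed
  have "(\<lambda>n. iterated_diff l (\<lambda>j. ln (q n j)) k) \<longlonglongrightarrow>
      iterated_diff l (\<lambda>j. real j * ln p + (ln (1 + r ^ j) + - ln 2)) k"
    by (intro tendsto_iterated_diff ln_q)
  also have "iterated_diff l (\<lambda>j. real j * ln p + (ln (1 + r ^ j) + - ln 2)) k =
      iterated_diff l (\<lambda>j. ln (1 + r ^ j)) k"
    using l by (simp only: iterated_diff_add iterated_diff_linear iterated_diff_const) simp
  finally have "\<forall>\<^sub>F n in sequentially. iterated_diff l (\<lambda>j. ln (q n j)) k < 0"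
    using neg by (rule order_tendstoD(2))
  thus ?thesis
    using eventually_ge_at_top[of "k + l"]
  proof eventually_elim
    case (elim n)
    show ?case
    proof
      assume rep: "curie_weiss_01 n (\<beta> / real n) \<in> poisson_representable {1..n}"
      have "iterated_diff (card {k+1..k+l}) (\<lambda>j. ln (q n j)) (card {1..k}) \<ge> 0"
        by (rule poisson_representable_iterated_diff_nonneg[OF _ rep])
           (use elim l in \<open>auto simp: q_def prob_curie_weiss_01_zero\<close>)
      thus False using elim by simp
    qed
  qed
qed

end
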